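(* Let $\rho>0$. Then: (a) There exists a unique stationary $\mathcal H_K^{++}$-valued process $(\mathsf W_n)_{n\in\mathbb Z}$ satisfying \[ \mathsf W_n = \left( I + \rho \, \mathsf G_n^* \left( I + \rho \,\mathsf F_n \mathsf W_{n-1} \mathsf F_n^* \right)^{-1} \mathsf G_n \right)^{-1}. \] In particular, the process $(\mathsf W_n)$ is ergodic. (b) The mutual information per component admits the representation \[ \mathcal I_\rho = \frac1N\Big( \mathbb E\log\det\left( I + \rho \,\mathsf F_0 \mathsf W_{-1} \mathsf F_0^* \right)-\mathbb E \log\det \mathsf W_0 \Big). \] (c) Given any matrix $\mathsf X_{-1} \in \mathcal H_K^{+}$, if one defines a process $(\mathsf X_n)_{n\in\mathbb N}$ by \[ \mathsf X_n := \left( I + \rho \, \mathsf G_n^* \left( I + \rho \,\mathsf F_n \mathsf X_{n-1} \mathsf F_n^* \right)^{-1} \mathsf G_n \right)^{-1}, \qquad n\geq 0, \] then almost surely \[ \mathcal I_\rho = \lim_{n\to\infty} \frac{1}{nN} \sum_{\ell=0}^{n-1} \Big(\log\det \left( I + \rho \,\mathsf F_\ell \mathsf X_{\ell-1} \mathsf F_\ell^* \right) - \log\det \mathsf X_\ell\Big). \]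
   Context: Consider the transmission model $Y_n = \mathsf F_n S_{n-1} + \mathsf G_n S_n + V_n$, $n\in\mathbb Z$, with $\mathsf F_n,\mathsf G_n\in\mathbb C^{N\times K}$, where $(S_n)$ is i.i.d. $\mathcal{CN}(0,I_K)$, $(V_n)$ is i.i.d. $\mathcal{CN}(0,\rho^{-1}I_N)$, and $(S_n)$, $(\mathsf F_n,\mathsf G_n)$, $(V_n)$ are independent. Assume the channel process $(\mathsf F_n,\mathsf G_n)_{n\in\mathbb Z}$, with values in $E:=\mathbb C^{N\times K}\times\mathbb C^{N\times K}$, is stationary and ergodic with $\mathbb E\|\mathsf F_0\|^2<\infty$ and $\mathbb E\|\mathsf G_0\|^2<\infty$ (spectral norm). For $m\le n$ let $\mathsf H_{m,n}$ be the $(n-m+1)N\times(n-m+2)K$ block bidiagonal matrix whose $i$-th block row (for $i=m,\dots,n$) contains $\mathsf F_i$ and $\mathsf G_i$ in consecutive block columns $i-m+1$ and $i-m+2$ and zeros elsewhere. The mutual information per component is $\mathcal I_\rho := \lim_{n-m\to\infty}\frac{1}{(n-m+1)N}\log\det(I+\rho\,\mathsf H_{m,n}\mathsf H_{m,n}^* )$ a.s. (equal to the limit of the expectations). $\mathcal H_K^{++}$ (resp. $\mathcal H_K^{+}$) denotes the cone of $K\times K$ Hermitian positive definite (resp. semidefinite) matrices. *)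

theory Defs
  imports "HOL-Probability.Probability"
begin

definition cadj :: "complex^'b^'a \<Rightarrow> complex^'a^'b" where
  "cadj A = (\<chi> i j. cnj (A $ j $ i))"

definition qform :: "complex^'a^'a \<Rightarrow> complex^'a \<Rightarrow> complex" where
  "qform A x = (\<Sum>i\<in>UNIV. \<Sum>j\<in>UNIV. cnj (x $ i) * A $ i $ j * x $ j)"

definition hpd :: "complex^'a^'a \<Rightarrow> bool" where
  "hpd A \<longleftrightarrow> cadj A = A \<and> (\<forall>x. x \<noteq> 0 \<longrightarrow> 0 < Re (qform A x))"

definition hpsd :: "complex^'a^'a \<Rightarrow> bool" where
  "hpsd A \<longleftrightarrow> cadj A = A \<and> (\<forall>x. 0 \<le> Re (qform A x))"

text \<open>log det of a matrix with positive real determinant.\<close>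
definition ldet :: "complex^'a^'a \<Rightarrow> real" where
  "ldet A = ln (Re (det A))"

definition specnorm :: "complex^'b^'a \<Rightarrow> real" where
  "specnorm A = onorm (\<lambda>x. A *v x)"

definition Wmap :: "real \<Rightarrow> complex^'k^'n \<Rightarrow> complex^'k^'n \<Rightarrow> complex^'k^'k \<Rightarrow> complex^'k^'k" where
  "Wmap \<rho> F G W = matrix_inv (mat 1 + \<rho> *\<^sub>R (cadj G ** matrix_inv (mat 1 + \<rho> *\<^sub>R (F ** W ** cadj F)) ** G))"

definition ldetF :: "real \<Rightarrow> complex^'k^'n \<Rightarrow> complex^'k^'k \<Rightarrow> real" where
  "ldetF \<rho> F W = ldet (mat 1 + \<rho> *\<^sub>R (F ** W ** cadj F))"

abbreviation path_space :: "(int \<Rightarrow> 'e::topological_space) measure" where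
  "path_space \<equiv> PiM (UNIV :: int set) (\<lambda>_. borel)"

definition shift :: "(int \<Rightarrow> 'e) \<Rightarrow> (int \<Rightarrow> 'e)" where
  "shift x = (\<lambda>n. x (n + 1))"

definition stationary_proc :: "'w measure \<Rightarrow> ('w \<Rightarrow> int \<Rightarrow> 'e::topological_space) \<Rightarrow> bool" where
  "stationary_proc M X \<longleftrightarrow> X \<in> M \<rightarrow>\<^sub>M path_space \<and>
     distr M path_space (\<lambda>\<omega>. shift (X \<omega>)) = distr M path_space X"

definition ergodic_proc :: "'w measure \<Rightarrow> ('w \<Rightarrow> int \<Rightarrow> 'e::topological_space) \<Rightarrow> bool" where
  "ergodic_proc M X \<longleftrightarrow> (\<forall>A \<in> sets (path_space :: (int \<Rightarrow> 'e) measure).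
     shift -` A \<inter> space path_space = A \<longrightarrow>
       measure (distr M path_space X) A = 0 \<or> measure (distr M path_space X) A = 1)"

definition enum_ix :: "nat \<Rightarrow> 'a::finite" where
  "enum_ix = (SOME f. bij_betw f {..<CARD('a)} (UNIV :: 'a set))"

definition ent :: "complex^'k^'n \<Rightarrow> nat \<Rightarrow> nat \<Rightarrow> complex" where
  "ent A a b = A $ enum_ix a $ enum_ix b"

text \<open>The block bidiagonal matrix H_{m,n} ((n-m+1)N x (n-m+2)K), 0-based entries:
  block row i (0 \<le> i \<le> n-m) holds F_{m+i} in block column i and G_{m+i} in block column i+1.\<close>
definition Hmat :: "(int \<Rightarrow> complex^'k^'n) \<Rightarrow> (int \<Rightarrow> complex^'k^'n) \<Rightarrow> int \<Rightarrow> nat \<Rightarrow> nat \<Rightarrow> complex" where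
  "Hmat F G m r c =
     (let i = r div CARD('n); a = r mod CARD('n); j = c div CARD('k); b = c mod CARD('k) in
      if j = i then ent (F (m + int i)) a b
      else if j = i + 1 then ent (G (m + int i)) a b else 0)"

definition det_nat :: "nat \<Rightarrow> (nat \<Rightarrow> nat \<Rightarrow> complex) \<Rightarrow> complex" where
  "det_nat n A = (\<Sum>p | p permutes {..<n}. of_int (sign p) * (\<Prod>i<n. A i (p i)))"

definition logdet_H :: "real \<Rightarrow> (int \<Rightarrow> complex^'k^'n) \<Rightarrow> (int \<Rightarrow> complex^'k^'n) \<Rightarrow> int \<Rightarrow> int \<Rightarrow> real" where
  "logdet_H \<rho> F G m n =
     (let R = nat (n - m + 1) * CARD('n); C = nat (n - m + 2) * CARD('k) in
      ln (Re (det_nat R (\<lambda>r r'. (if r = r' then 1 else 0) +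
          complex_of_real \<rho> * (\<Sum>c<C. Hmat F G m r c * cnj (Hmat F G m r' c))))))"

definition MI_approx :: "'w measure \<Rightarrow> real \<Rightarrow> ('w \<Rightarrow> int \<Rightarrow> (complex^'k^'n) \<times> (complex^'k^'n)) \<Rightarrow> int \<times> int \<Rightarrow> real" where
  "MI_approx M \<rho> FG mn = (case mn of (m, n) \<Rightarrow>
     (\<integral>\<omega>. logdet_H \<rho> (\<lambda>i. fst (FG \<omega> i)) (\<lambda>i. snd (FG \<omega> i)) m n \<partial>M)
       / (real_of_int (n - m + 1) * real CARD('n)))"

abbreviation gap_filter :: "(int \<times> int) filter" where
  "gap_filter \<equiv> filtercomap (\<lambda>(m, n). n - m) at_top"

definition mutual_info :: "'w measure \<Rightarrow> real \<Rightarrow> ('w \<Rightarrow> int \<Rightarrow> (complex^'k^'n) \<times> (complex^'k^'n)) \<Rightarrow> real" where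
  "mutual_info M \<rho> FG = Lim gap_filter (MI_approx M \<rho> FG)"

text \<open>The process X_n of part (c): Xseq ... 0 = X_{-1}, Xseq ... (l+1) = X_l.\<close>
primrec Xseq :: "real \<Rightarrow> (int \<Rightarrow> complex^'k^'n) \<Rightarrow> (int \<Rightarrow> complex^'k^'n) \<Rightarrow> complex^'k^'k \<Rightarrow> nat \<Rightarrow> complex^'k^'k" where
  "Xseq \<rho> F G X0 0 = X0"
| "Xseq \<rho> F G X0 (Suc l) = Wmap \<rho> (F (int l)) (G (int l)) (Xseq \<rho> F G X0 l)"

end

theory Submission
  imports "Jordan_Normal_Form.Char_Poly" Defs
begin

text \<open>
The recursion W \<mapsto> Wmap F G W is monotone for the Loewner order and maps positive semidefinite
matrices into the order interval [0, 1]. On that interval it contracts multiplicatively: if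
t X \<preceq> Y then s (Wmap X) \<preceq> Wmap Y with 1 - s = (1 - t) q, where
q = \<rho> |F|^2 / (1 + \<rho> |F|^2) < 1. Products of the factors q along a stationary path tend to 0 almost
surely, because such a product p satisfies p = q (p shifted) while p and its shift have equal means.
So on almost every path all iterates started in [0, 1] merge; their limit is the unique solution, and being an
equivariant function of the path it inherits stationarity and ergodicity.

Block Gaussian elimination of 1 + \<rho> H H* with Woodbury's identity reproduces the recursion started at
the identity, which writes its log determinant as a sum of the increments
log det (1 + \<rho> F X F*) - log det (Wmap X). Dominated convergence and Cesaro means give the mean
limit, Birkhoff's theorem the almost sure one; the increments of two merging orbits are compared through the
eigenvalues of a Hermitian pencil.
\<close>

text \<open>No uniform rate is available: F need not be bounded, so q can come arbitrarily close to
  1. The multiplicative relation t X \<preceq> Y is suited to this in two ways. It may start at t =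
  0, where it holds for any two positive semidefinite matrices, and its factor q depends on the
  channel alone, so the product p is one function of the path that controls all pairs of orbits at
  once. Moreover it bounds the difference of two log determinants by a multiple of - ln t whatever
  the size of F, whereas a distance in norm would have to be multiplied by |F|^2 before increments
  could be compared. The product is used in two directions: backward from a fixed end time it makes
  the limit from the remote past exist, forward from a fixed start time it makes orbits forget their
  initial matrix, as (c) requires. Each direction satisfies the functional equation for its own
  shift, one step backward or one step forward.\<close>

no_notation vec_index (infixl \<open>$\<close> 100)
no_notation scalar_prod (infix \<open>\<bullet>\<close> 70)

section \<open>Determinants of matrices indexed by finite types\<close>

lemma bij_betw_enum_ix: "bij_betw (enum_ix :: nat \<Rightarrow> 'a::finite) {..<CARD('a)} UNIV"
proof -
  have "\<exists>f. bij_betw f {..<CARD('a)} (UNIV :: 'a set)"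
    using ex_bij_betw_nat_finite[of "UNIV :: 'a set"] by (simp add: atLeast0LessThan)
  then show ?thesis unfolding enum_ix_def by (rule someI_ex)
qed

lemma enum_ix_eq_iff:
  assumes "i < CARD('a::finite)" "j < CARD('a)"
  shows "(enum_ix i :: 'a) = enum_ix j \<longleftrightarrow> i = j"
  using bij_betw_enum_ix[where 'a='a] assms by (auto simp: bij_betw_def inj_on_def)

lemma sum_enum_ix: "(\<Sum>i<CARD('a::finite). f (enum_ix i :: 'a)) = sum f UNIV"
  using sum.reindex_bij_betw[OF bij_betw_enum_ix[where 'a='a], of f] by simp

lemma prod_enum_ix: "(\<Prod>i<CARD('a::finite). f (enum_ix i :: 'a)) = prod f UNIV"
  using prod.reindex_bij_betw[OF bij_betw_enum_ix[where 'a='a], of f] by simp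

text \<open>Conjugation with the enumeration carries the permutations of
  \<open>{..<CARD('n)}\<close> bijectively to those of the index type and preserves signs.\<close>

lemma det_nat_ent:
  fixes A :: "complex^'n^'n"
  shows "det_nat CARD('n) (ent A) = det A"
proof -
  let ?e = "enum_ix :: nat \<Rightarrow> 'n" and ?S = "{..<CARD('n)}"
  have bij: "bij_betw ?e ?S UNIV" by (rule bij_betw_enum_ix)
  have inj: "inj_on ?e ?S" using bij by (simp add: bij_betw_def)
  have b: "bij_betw (map_permutation ?S ?e) {p. p permutes ?S} {p. p permutes (UNIV :: 'n set)}"
  proof (rule bij_betw_byWitness[where f' = "map_permutation UNIV (inv_into ?S ?e)"])
    have bij': "bij_betw (inv_into ?S ?e) UNIV ?S" by (rule bij_betw_inv_into[OF bij])
    show "\<forall>p\<in>{p. p permutes ?S}. map_permutation UNIV (inv_into ?S ?e) (map_permutation ?S ?e p) = p"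
      using map_permutation_compose_inv[OF bij] inj by auto
    show "\<forall>p\<in>{p. p permutes (UNIV::'n set)}. map_permutation ?S ?e (map_permutation UNIV (inv_into ?S ?e) p) = p"
      using map_permutation_compose_inv[OF bij', of _ ?e] bij
      by (metis bij_betw_inv_into_right iso_tuple_UNIV_I mem_Collect_eq)
    show "map_permutation ?S ?e ` {p. p permutes ?S} \<subseteq> {p. p permutes (UNIV::'n set)}"
      using map_permutation_permutes[OF bij] by auto
    show "map_permutation UNIV (inv_into ?S ?e) ` {p. p permutes (UNIV::'n set)} \<subseteq> {p. p permutes ?S}"
      using map_permutation_permutes[OF bij'] by auto
  qed
  have "det A = (\<Sum>p\<in>{p. p permutes (UNIV::'n set)}. of_int (sign p) * (\<Prod>i\<in>UNIV. A $ i $ p i))"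
    by (simp add: Determinants.det_def)
  also have "\<dots> = (\<Sum>p\<in>{p. p permutes ?S}. of_int (sign (map_permutation ?S ?e p)) *
      (\<Prod>i\<in>UNIV. A $ i $ (map_permutation ?S ?e p) i))"
    by (rule sum.reindex_bij_betw[OF b, symmetric])
  also have "\<dots> = (\<Sum>p\<in>{p. p permutes ?S}. of_int (sign p) * (\<Prod>i<CARD('n). ent A i (p i)))"
  proof (rule sum.cong[OF refl])
    fix p assume "p \<in> {p. p permutes ?S}"
    then have p: "p permutes ?S" by simp
    have "(\<Prod>i\<in>UNIV. A $ i $ (map_permutation ?S ?e p) i)
        = (\<Prod>i<CARD('n). A $ ?e i $ (map_permutation ?S ?e p) (?e i))"
      by (rule prod_enum_ix[symmetric])
    also have "\<dots> = (\<Prod>i<CARD('n). ent A i (p i))"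
      by (intro prod.cong refl) (simp add: map_permutation_apply[OF inj] ent_def)
    finally show "of_int (sign (map_permutation ?S ?e p)) * (\<Prod>i\<in>UNIV. A $ i $ (map_permutation ?S ?e p) i)
       = of_int (sign p) * (\<Prod>i<CARD('n). ent A i (p i))"
      using sign_map_permutation[OF inj p] by simp
  qed
  also have "\<dots> = det_nat CARD('n) (ent A)" by (simp add: det_nat_def)
  finally show ?thesis by simp
qed

lemma det_nat_eq_det_mat: "det_nat n f = Determinant.det (Matrix.mat n n (\<lambda>(i,j). f i j))"
  unfolding det_nat_def
  by (subst det_def'[of _ n]) (auto intro!: sum.cong prod.cong simp: atLeast0LessThan permutes_in_image)

text \<open>Here the dimension is a number instead of a type, so that matrices with a variable
  number of blocks can be split into four blocks.\<close>

definition jmat :: "complex^'b^'a \<Rightarrow> complex Matrix.mat" where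
  "jmat A = Matrix.mat CARD('a) CARD('b) (\<lambda>(i,j). ent A i j)"

lemma jmat_carrier [simp]: "jmat (A :: complex^'b^'a) \<in> carrier_mat CARD('a) CARD('b)"
  by (simp add: jmat_def)

lemma det_jmat: "Determinant.det (jmat A) = det A"
  by (simp add: jmat_def flip: det_nat_ent det_nat_eq_det_mat)

lemma jmat_mult: "jmat (A ** B) = jmat A * jmat (B :: complex^'c^'b)"
  by (rule eq_matI)
    (auto simp: jmat_def ent_def matrix_matrix_mult_def Matrix.scalar_prod_def atLeast0LessThan sum_enum_ix[symmetric])

lemma jmat_diff: "jmat (A - B) = jmat A - jmat B"
  by (rule eq_matI) (auto simp: jmat_def ent_def)

lemma jmat_one: "jmat (mat 1 :: complex^'a^'a) = 1\<^sub>m CARD('a)"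
  by (rule eq_matI) (auto simp: jmat_def ent_def mat_def enum_ix_eq_iff)


text \<open>Block LU factorization with \<open>A\<close> as pivot.\<close>

lemma det_four_block_mat_schur:
  fixes A :: "complex Matrix.mat"
  assumes c: "A \<in> carrier_mat n n" "B \<in> carrier_mat n m" "C \<in> carrier_mat m n" "D \<in> carrier_mat m m"
    and A': "A' \<in> carrier_mat n n" "A * A' = 1\<^sub>m n" "A' * A = 1\<^sub>m n"
  shows "Determinant.det (four_block_mat A B C D) = Determinant.det A * Determinant.det (D - C * A' * B)"
proof -
  have B': "A' * B \<in> carrier_mat n m" and S: "D - C * A' * B \<in> carrier_mat m m"
    and CB: "C * A' * B \<in> carrier_mat m m"
    using c A' by auto
  have "A * (A' * B) = B"
    using assoc_mult_mat[OF c(1) A'(1) c(2)] A'(2) c(2) by simp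
  moreover have "C * (A' * B) + (D - C * A' * B) = D"
    using assoc_mult_mat[OF c(3) A'(1) c(2)] c CB by (auto intro!: eq_matI)
  ultimately have M: "four_block_mat A B C D = four_block_mat A (0\<^sub>m n m) C (1\<^sub>m m) *
     four_block_mat (1\<^sub>m n) (A' * B) (0\<^sub>m m n) (D - C * A' * B)"
    using mult_four_block_mat[OF c(1) zero_carrier_mat c(3) one_carrier_mat one_carrier_mat B' zero_carrier_mat S] c B' S
    by simp
  show ?thesis
    unfolding M
    apply (subst Determinant.det_mult[where n="n + m"])
    using c S apply (auto)[2]
    apply (subst det_four_block_mat_upper_right_zero[OF c(1) refl c(3) one_carrier_mat])
    apply (subst det_four_block_mat_lower_left_zero[OF one_carrier_mat B' refl S])
    apply simp
    done
qed

text \<open>Elimination from the opposite corner, with the identity as pivot.\<close>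

lemma det_four_block_mat_one:
  fixes A :: "complex Matrix.mat"
  assumes c: "A \<in> carrier_mat n n" "B \<in> carrier_mat n m" "C \<in> carrier_mat m n"
  shows "Determinant.det (four_block_mat A B C (1\<^sub>m m)) = Determinant.det (A - B * C)"
proof -
  have S: "A - B * C \<in> carrier_mat n n" and BC: "B * C \<in> carrier_mat n n"
    using c by auto
  have "A - B * C + B * C = A"
    using c BC by (auto intro!: eq_matI)
  then have M: "four_block_mat A B C (1\<^sub>m m) = four_block_mat (A - B * C) B (0\<^sub>m m n) (1\<^sub>m m) *
     four_block_mat (1\<^sub>m n) (0\<^sub>m n m) C (1\<^sub>m m)"
    using mult_four_block_mat[OF S c(2) zero_carrier_mat one_carrier_mat one_carrier_mat zero_carrier_mat c(3) one_carrier_mat] c S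
    by simp
  show ?thesis
    unfolding M
    apply (subst Determinant.det_mult[where n="n + m"])
    using c S apply (auto)[2]
    apply (subst det_four_block_mat_upper_right_zero[OF one_carrier_mat refl c(3) one_carrier_mat])
    apply (subst det_four_block_mat_lower_left_zero[OF S c(2) refl one_carrier_mat])
    apply simp
    done
qed

text \<open>Both eliminations are applied to the same matrix with blocks \<open>S\<close>,
  \<open>B\<close>, \<open>C\<close> and the identity. This trades a determinant over
  \<open>'k\<close> for one over \<open>'n\<close>.\<close>

lemma det_schur_complement_exchange:
  fixes S :: "complex^'n^'n" and B :: "complex^'k^'n" and C :: "complex^'n^'k"
  assumes T: "S ** T = mat 1" "T ** S = mat 1"
  shows "det S * det (mat 1 - C ** T ** B) = det (S - B ** C)"
proof -
  have "Determinant.det (four_block_mat (jmat S) (jmat B) (jmat C) (1\<^sub>m CARD('k)))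
      = Determinant.det (jmat S) * Determinant.det (1\<^sub>m CARD('k) - jmat C * jmat T * jmat B)"
    using T by (intro det_four_block_mat_schur[where n="CARD('n)" and m="CARD('k)"]) (auto simp flip: jmat_mult jmat_one)
  moreover have "Determinant.det (four_block_mat (jmat S) (jmat B) (jmat C) (1\<^sub>m CARD('k)))
      = Determinant.det (jmat S - jmat B * jmat C)"
    by (rule det_four_block_mat_one[where n="CARD('n)" and m="CARD('k)"]) auto
  ultimately show ?thesis
    by (simp add: det_jmat flip: jmat_mult jmat_one jmat_diff)
qed

section \<open>Splitting of the characteristic polynomial and block determinants\<close>

lemma char_poly_jmat: "poly (char_poly (jmat (A :: complex^'n^'n))) z = det (mat z - A)"
proof -
  have "- char_matrix (jmat A) z = jmat (mat z - A)"
    by (rule eq_matI) (auto simp: char_matrix_def jmat_def ent_def mat_def enum_ix_eq_iff)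
  then show ?thesis
    by (simp add: char_poly_matrix[OF jmat_carrier] det_jmat)
qed

text \<open>The list records the complex roots with multiplicity, so that bounds on single roots
  become bounds on the determinant.\<close>

lemma det_shift_factorization:
  fixes A :: "complex^'n^'n"
  obtains as where "length as = CARD('n)" "\<And>z. det (mat z - A) = (\<Prod>a\<leftarrow>as. z - a)"
proof -
  obtain as where as: "char_poly (jmat A) = (\<Prod>a\<leftarrow>as. [:- a, 1:])" "length as = CARD('n)"
    using char_poly_factorized[OF jmat_carrier[of A]] by auto
  have "det (mat z - A) = (\<Prod>a\<leftarrow>as. z - a)" for z
    unfolding char_poly_jmat[symmetric] as(1) by (induction as) (auto simp: algebra_simps)
  then show ?thesis using as(2) that by blast
qed

definition bdet :: "nat \<Rightarrow> (nat \<Rightarrow> nat \<Rightarrow> complex^'n^'n) \<Rightarrow> complex" where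
  "bdet L B = det_nat (L * CARD('n)) (\<lambda>r s. ent (B (r div CARD('n)) (s div CARD('n))) (r mod CARD('n)) (s mod CARD('n)))"

lemma bdet_0: "bdet 0 B = 1"
  by (simp add: bdet_def det_nat_def)

text \<open>One step of block Gaussian elimination: the Schur complement of block (0, 0) is again a
  block matrix, with block indices lowered by one, so the step can be iterated.\<close>

lemma bdet_Suc:
  fixes B :: "nat \<Rightarrow> nat \<Rightarrow> complex^'n^'n"
  assumes T: "B 0 0 ** T = mat 1" "T ** B 0 0 = mat 1"
  shows "bdet (Suc L) B = det (B 0 0) * bdet L (\<lambda>i j. B (Suc i) (Suc j) - B (Suc i) 0 ** T ** B 0 (Suc j))"
proof -
  let ?n = "CARD('n)" and ?m = "L * CARD('n)"
  let ?f = "\<lambda>r s. ent (B (r div ?n) (s div ?n)) (r mod ?n) (s mod ?n)"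
  let ?R = "Matrix.mat ?n ?m (\<lambda>(r,s). ent (B 0 (Suc (s div ?n))) r (s mod ?n))"
  let ?C = "Matrix.mat ?m ?n (\<lambda>(r,s). ent (B (Suc (r div ?n)) 0) (r mod ?n) s)"
  let ?D = "Matrix.mat ?m ?m (\<lambda>(r,s). ent (B (Suc (r div ?n)) (Suc (s div ?n))) (r mod ?n) (s mod ?n))"
  \<comment> \<open>Beyond the first block row, subtracting \<open>?n\<close> lowers the block index
    by one and keeps the index inside the block.\<close>
  have div: "r div ?n = Suc ((r - ?n) div ?n)" "r mod ?n = (r - ?n) mod ?n" if "\<not> r < ?n" for r
    using that by (simp_all add: le_div_geq le_mod_geq)
  have M: "Matrix.mat (Suc L * ?n) (Suc L * ?n) (\<lambda>(r,s). ?f r s) = four_block_mat (jmat (B 0 0)) ?R ?C ?D"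
    by (rule eq_matI) (auto simp: jmat_def div)
  have S: "?D - ?C * jmat T * ?R = Matrix.mat ?m ?m (\<lambda>(r,s).
     ent (B (Suc (r div ?n)) (Suc (s div ?n)) - B (Suc (r div ?n)) 0 ** T ** B 0 (Suc (s div ?n))) (r mod ?n) (s mod ?n))"
  proof (rule eq_matI)
    fix r s assume "r < dim_row (Matrix.mat ?m ?m (\<lambda>(r,s).
     ent (B (Suc (r div ?n)) (Suc (s div ?n)) - B (Suc (r div ?n)) 0 ** T ** B 0 (Suc (s div ?n))) (r mod ?n) (s mod ?n)))"
    and "s < dim_col (Matrix.mat ?m ?m (\<lambda>(r,s).
     ent (B (Suc (r div ?n)) (Suc (s div ?n)) - B (Suc (r div ?n)) 0 ** T ** B 0 (Suc (s div ?n))) (r mod ?n) (s mod ?n)))"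
    then have rs: "r < ?m" "s < ?m" by auto
    let ?P = "B (Suc (r div ?n)) 0" and ?Q = "B 0 (Suc (s div ?n))"
    have ms: "r mod ?n < ?n" "s mod ?n < ?n" by auto
    have CT: "(?C * jmat T) $$ (r, k) = (jmat ?P * jmat T) $$ (r mod ?n, k)" if "k < ?n" for k
      using rs ms that by (simp add: jmat_def Matrix.scalar_prod_def)
    have "ent (?P ** T ** ?Q) (r mod ?n) (s mod ?n) = (jmat (?P ** T ** ?Q)) $$ (r mod ?n, s mod ?n)"
      using ms by (simp add: jmat_def)
    also have "\<dots> = (\<Sum>k<?n. (jmat ?P * jmat T) $$ (r mod ?n, k) * jmat ?Q $$ (k, s mod ?n))"
      unfolding jmat_mult
      using ms carrier_matD[OF jmat_carrier[of ?P]] carrier_matD[OF jmat_carrier[of T]] carrier_matD[OF jmat_carrier[of ?Q]]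
      by (subst index_mult_mat(1)) (auto simp: Matrix.scalar_prod_def atLeast0LessThan intro!: sum.cong)
    also have "\<dots> = (?C * jmat T * ?R) $$ (r, s)"
      using rs ms carrier_matD[OF jmat_carrier[of T]]
      by (subst index_mult_mat(1)[of r "?C * jmat T"])
        (auto simp: Matrix.scalar_prod_def[of "Matrix.row (?C * jmat T) r"] atLeast0LessThan CT[symmetric] jmat_def[of ?Q] simp del: index_mult_mat(1) intro!: sum.cong)
    finally show "(?D - ?C * jmat T * ?R) $$ (r, s) = Matrix.mat ?m ?m (\<lambda>(r,s).
     ent (B (Suc (r div ?n)) (Suc (s div ?n)) - B (Suc (r div ?n)) 0 ** T ** B 0 (Suc (s div ?n))) (r mod ?n) (s mod ?n)) $$ (r, s)"
      using rs by (simp add: ent_def)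
  qed auto
  show ?thesis
    unfolding bdet_def det_nat_eq_det_mat M
    by (subst det_four_block_mat_schur[where n="?n" and m="?m" and A'="jmat T"])
      (auto simp: det_jmat S T simp flip: jmat_mult jmat_one)
qed

section \<open>The Loewner order\<close>

text \<open>The real inner product on \<open>complex^'a\<close> is the real part of the Hermitian
  one, so semidefiniteness can be read off the real Euclidean structure.\<close>

lemma Re_qform: "Re (qform A x) = x \<bullet> (A *v x)"
  by (simp add: qform_def matrix_vector_mult_def inner_vec_def inner_complex_def sum_distrib_left
      algebra_simps sum.distrib sum_subtractf)

lemma qform_eq_sum_mult: "qform A x = (\<Sum>i\<in>UNIV. cnj (x $ i) * (A *v x) $ i)"
  by (simp add: qform_def matrix_vector_mult_def sum_distrib_left algebra_simps)

lemma cadj_cadj [simp]: "cadj (cadj A) = A"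
  by (simp add: cadj_def vec_eq_iff)

lemma cadj_mult: "cadj (A ** B) = cadj B ** cadj A"
  by (simp add: cadj_def matrix_matrix_mult_def vec_eq_iff mult.commute)

lemma cadj_add: "cadj (A + B) = cadj A + cadj B"
  by (simp add: cadj_def vec_eq_iff)

lemma cadj_diff: "cadj (A - B) = cadj A - cadj B"
  by (simp add: cadj_def vec_eq_iff)

lemma cadj_scaleR: "cadj (r *\<^sub>R A) = r *\<^sub>R cadj A"
  by (simp add: cadj_def vec_eq_iff)

lemma cadj_one [simp]: "cadj (mat 1) = mat 1"
  by (auto simp: cadj_def mat_def vec_eq_iff)

lemma cadj_zero [simp]: "cadj 0 = 0"
  by (simp add: cadj_def vec_eq_iff)

lemma inner_matrix_vector_cadj: "x \<bullet> (A *v y) = (cadj A *v x) \<bullet> y"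
proof -
  have "x \<bullet> (A *v y) = (\<Sum>i\<in>UNIV. \<Sum>j\<in>UNIV. Re (cnj (x $ i) * A $ i $ j * y $ j))"
    by (simp add: matrix_vector_mult_def inner_vec_def inner_complex_def sum_distrib_left
      algebra_simps sum.distrib sum_subtractf)
  also have "\<dots> = (\<Sum>j\<in>UNIV. \<Sum>i\<in>UNIV. Re (cnj (x $ i) * A $ i $ j * y $ j))"
    by (rule sum.swap)
  also have "\<dots> = (cadj A *v x) \<bullet> y"
    by (simp add: cadj_def matrix_vector_mult_def inner_vec_def inner_complex_def sum_distrib_left
      sum_distrib_right algebra_simps sum.distrib sum_subtractf)
  finally show ?thesis .
qed

lemma hpsd_iff: "hpsd A \<longleftrightarrow> cadj A = A \<and> (\<forall>x. 0 \<le> x \<bullet> (A *v x))"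
  by (simp add: hpsd_def Re_qform)

lemma hpd_iff: "hpd A \<longleftrightarrow> cadj A = A \<and> (\<forall>x. x \<noteq> 0 \<longrightarrow> 0 < x \<bullet> (A *v x))"
  by (simp add: hpd_def Re_qform)

lemma hpd_imp_hpsd: "hpd A \<Longrightarrow> hpsd A"
  unfolding hpd_iff hpsd_iff by (metis inner_zero_left less_eq_real_def)

lemma scaleR_mult_mat: "(r *\<^sub>R A) ** B = r *\<^sub>R (A ** (B :: complex^'c^'b))"
  by (simp add: matrix_matrix_mult_def vec_eq_iff scaleR_sum_right)

lemma mult_scaleR_mat: "A ** (r *\<^sub>R B) = r *\<^sub>R (A ** (B :: complex^'c^'b))"
  by (simp add: matrix_matrix_mult_def vec_eq_iff scaleR_sum_right)

lemma scaleR_mult_vec: "(r *\<^sub>R A) *v x = r *\<^sub>R (A *v (x :: complex^'b))"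
  by (simp add: matrix_vector_mult_def vec_eq_iff scaleR_sum_right)

text \<open>\<open>norm\<close> of a matrix is its Frobenius norm, which dominates the operator norm
  by Cauchy-Schwarz in each row. All estimates use it; the spectral norm of the hypotheses is
  converted at the end.\<close>

lemma norm_mult_vec_le: "norm (A *v x) \<le> norm A * norm (x :: complex^'b)"
proof -
  have "norm ((A *v x) $ i) \<le> norm (A $ i) * norm x" for i
  proof -
    have "norm ((A *v x) $ i) \<le> (\<Sum>j\<in>UNIV. norm (A $ i $ j * x $ j))"
      by (simp add: matrix_vector_mult_def norm_sum)
    also have "\<dots> = (\<Sum>j\<in>UNIV. \<bar>norm (A $ i $ j)\<bar> * \<bar>norm (x $ j)\<bar>)"
      by (simp add: norm_mult)
    also have "\<dots> \<le> norm (A $ i) * norm x"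
      unfolding norm_vec_def by (rule L2_set_mult_ineq)
    finally show ?thesis .
  qed
  then have "norm (A *v x) \<le> L2_set (\<lambda>i. norm (A $ i) * norm x) UNIV"
    unfolding norm_vec_def[of "A *v x"] by (intro L2_set_mono) auto
  also have "\<dots> = norm A * norm x"
    by (simp add: norm_vec_def[of A] L2_set_left_distrib)
  finally show ?thesis .
qed

lemma norm_cadj: "norm (cadj A) = norm A"
proof -
  have n: "(norm B)\<^sup>2 = (\<Sum>i\<in>UNIV. \<Sum>j\<in>UNIV. (norm (B $ i $ j))\<^sup>2)" for B :: "complex^'x^'y"
    by (simp add: norm_vec_def L2_set_def sum_nonneg)
  have "(norm (cadj A))\<^sup>2 = (norm A)\<^sup>2"
    unfolding n by (subst sum.swap) (simp add: cadj_def)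
  then show ?thesis by simp
qed

text \<open>Only the real parts of the quadratic forms are compared; that the matrices are Hermitian
  is a separate hypothesis where it matters.\<close>

definition loewner_le :: "complex^'a^'a \<Rightarrow> complex^'a^'a \<Rightarrow> bool" (infix \<open>\<preceq>\<close> 50) where
  "A \<preceq> B \<longleftrightarrow> (\<forall>x. x \<bullet> (A *v x) \<le> x \<bullet> (B *v x))"

lemma loewner_leD: "A \<preceq> B \<Longrightarrow> x \<bullet> (A *v x) \<le> x \<bullet> (B *v x)"
  by (simp add: loewner_le_def)

lemma loewner_refl [simp]: "A \<preceq> A"
  by (simp add: loewner_le_def)

lemma loewner_trans: "A \<preceq> B \<Longrightarrow> B \<preceq> C \<Longrightarrow> A \<preceq> C"
  by (meson loewner_le_def order_trans)

lemma loewner_add_mono: "A \<preceq> B \<Longrightarrow> C \<preceq> D \<Longrightarrow> A + C \<preceq> B + D"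
  by (simp add: loewner_le_def matrix_vector_mult_add_rdistrib inner_add_right add_mono)

lemma loewner_scaleR_mono: "A \<preceq> B \<Longrightarrow> 0 \<le> r \<Longrightarrow> r *\<^sub>R A \<preceq> r *\<^sub>R B"
  by (simp add: loewner_le_def scaleR_mult_vec mult_left_mono)

lemma loewner_scaleR_left_mono: "hpsd A \<Longrightarrow> r \<le> s \<Longrightarrow> r *\<^sub>R A \<preceq> s *\<^sub>R A"
  by (simp add: loewner_le_def scaleR_mult_vec mult_right_mono hpsd_iff)

lemma hpsd_iff_loewner: "hpsd A \<longleftrightarrow> cadj A = A \<and> 0 \<preceq> A"
  by (simp add: hpsd_iff loewner_le_def)

lemma conj_inner: "x \<bullet> ((C ** A ** cadj C) *v x) = (cadj C *v x) \<bullet> (A *v (cadj C *v x))"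
  by (simp add: inner_matrix_vector_cadj[of x C] flip: matrix_vector_mul_assoc)

lemma loewner_conj_mono: "A \<preceq> B \<Longrightarrow> C ** A ** cadj C \<preceq> C ** B ** cadj C"
  by (simp add: loewner_le_def conj_inner)

lemma hpsd_conj: "hpsd A \<Longrightarrow> hpsd (C ** A ** cadj C)"
  by (simp add: hpsd_iff conj_inner cadj_mult matrix_mul_assoc)

lemma loewner_conj_norm:
  assumes "A \<preceq> mat 1"
  shows "C ** A ** cadj C \<preceq> (norm C)\<^sup>2 *\<^sub>R mat 1"
  unfolding loewner_le_def
proof
  fix x
  have "x \<bullet> ((C ** A ** cadj C) *v x) \<le> (norm (cadj C *v x))\<^sup>2"
    using loewner_leD[OF assms, of "cadj C *v x"] by (simp add: conj_inner power2_norm_eq_inner)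
  also have "\<dots> \<le> (norm C * norm x)\<^sup>2"
    using norm_mult_vec_le[of "cadj C" x] by (intro power_mono) (auto simp: norm_cadj)
  finally show "x \<bullet> ((C ** A ** cadj C) *v x) \<le> x \<bullet> (((norm C)\<^sup>2 *\<^sub>R mat 1) *v x)"
    by (simp add: scaleR_mult_vec power_mult_distrib power2_norm_eq_inner)
qed

lemma hpd_one [simp]: "hpd (mat 1)"
  by (simp add: hpd_iff)

lemma hpsd_one [simp]: "hpsd (mat 1)"
  by (simp add: hpd_imp_hpsd)

lemma hpsd_scaleR: "hpsd A \<Longrightarrow> 0 \<le> r \<Longrightarrow> hpsd (r *\<^sub>R A)"
  by (simp add: hpsd_iff cadj_scaleR scaleR_mult_vec)

lemma hpd_scaleR: "hpd A \<Longrightarrow> 0 < r \<Longrightarrow> hpd (r *\<^sub>R A)"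
  by (simp add: hpd_iff cadj_scaleR scaleR_mult_vec)

lemma hpd_add_hpsd: "hpd A \<Longrightarrow> hpsd B \<Longrightarrow> hpd (A + B)"
  by (simp add: hpd_iff hpsd_iff cadj_add matrix_vector_mult_add_rdistrib inner_add_right add_pos_nonneg)

section \<open>Inverses of positive definite matrices\<close>

lemma hpd_inverse:
  assumes "hpd (A :: complex^'a^'a)"
  shows "A ** matrix_inv A = mat 1" "matrix_inv A ** A = mat 1"
proof -
  have "inj ((*v) A)"
  proof (rule injI)
    fix x y assume "A *v x = A *v y"
    then have "A *v (x - y) = 0" by (simp add: matrix_vector_mult_diff_distrib)
    then have "(x - y) \<bullet> (A *v (x - y)) = 0" by simp
    then show "x = y" using assms unfolding hpd_iff by (metis eq_iff_diff_eq_0 less_irrefl)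
  qed
  then obtain B where "B ** A = mat 1" using matrix_left_invertible_injective by blast
  then have "A ** B = mat 1 \<and> B ** A = mat 1" using matrix_left_right_inverse by blast
  then have "A ** matrix_inv A = mat 1 \<and> matrix_inv A ** A = mat 1"
    unfolding matrix_inv_def by (rule someI)
  then show "A ** matrix_inv A = mat 1" "matrix_inv A ** A = mat 1" by auto
qed

lemma matrix_inv_unique:
  fixes A B :: "complex^'a^'a"
  assumes "A ** B = mat 1" "B ** A = mat 1"
  shows "matrix_inv A = B"
proof -
  have "A ** matrix_inv A = mat 1 \<and> matrix_inv A ** A = mat 1"
    unfolding matrix_inv_def
    by (rule someI[where P="\<lambda>X. A ** X = mat 1 \<and> X ** A = mat 1", of B]) (simp add: assms)
  then have "matrix_inv A ** (A ** B) = B"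
    by (simp add: matrix_mul_assoc)
  then show ?thesis by (simp add: assms)
qed

lemma hpd_matrix_inv:
  assumes "hpd (A :: complex^'a^'a)"
  shows "hpd (matrix_inv A)"
proof -
  note i = hpd_inverse[OF assms]
  have h: "cadj A = A" using assms by (simp add: hpd_iff)
  have "cadj (matrix_inv A) ** A = mat 1" "A ** cadj (matrix_inv A) = mat 1"
    using arg_cong[OF i(1), of cadj] arg_cong[OF i(2), of cadj] by (simp_all add: cadj_mult h)
  then have c: "cadj (matrix_inv A) = matrix_inv A"
    by (metis matrix_inv_unique)
  have "0 < x \<bullet> (matrix_inv A *v x)" if "x \<noteq> 0" for x
  proof -
    let ?y = "matrix_inv A *v x"
    have x: "A *v ?y = x" by (simp add: matrix_vector_mul_assoc i)
    then have "?y \<noteq> 0" using that by auto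
    then have "0 < ?y \<bullet> (A *v ?y)" using assms by (simp add: hpd_iff)
    then show ?thesis by (simp add: x inner_commute)
  qed
  then show ?thesis using c by (simp add: hpd_iff)
qed

text \<open>No square root is taken. With Y z = y and X v = y, expanding the form of X at z - v
  gives 2 z.y \<le> z.Xz + v.y, and X \<preceq> Y bounds z.Xz by z.y.\<close>

lemma matrix_inv_antimono:
  assumes X: "hpd X" and Y: "hpd Y" and "X \<preceq> Y"
  shows "matrix_inv Y \<preceq> matrix_inv X"
  unfolding loewner_le_def
proof
  fix y
  define z where "z = matrix_inv Y *v y"
  define v where "v = matrix_inv X *v y"
  have z: "Y *v z = y" and v: "X *v v = y"
    by (simp_all add: z_def v_def matrix_vector_mul_assoc hpd_inverse X Y)
  have "z \<bullet> (X *v v) = (X *v z) \<bullet> v"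
    using X inner_matrix_vector_cadj[of z X v] by (simp add: hpd_iff)
  moreover have "0 \<le> (z - v) \<bullet> (X *v (z - v))"
    using hpd_imp_hpsd[OF X] by (simp add: hpsd_iff)
  ultimately have "0 \<le> z \<bullet> (X *v z) - 2 * (z \<bullet> y) + v \<bullet> y"
    by (simp add: matrix_vector_mult_diff_distrib inner_diff_left inner_diff_right v inner_commute)
  moreover have "z \<bullet> (X *v z) \<le> z \<bullet> y"
    using loewner_leD[OF assms(3), of z] by (simp add: z)
  ultimately show "y \<bullet> (matrix_inv Y *v y) \<le> y \<bullet> (matrix_inv X *v y)"
    by (simp add: inner_commute flip: z_def v_def)
qed

lemma matrix_inv_one [simp]: "matrix_inv (mat 1 :: complex^'a^'a) = mat 1"
  by (rule matrix_inv_unique) auto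

lemma matrix_inv_scaleR:
  assumes "hpd X" "r \<noteq> 0"
  shows "matrix_inv (r *\<^sub>R X) = (1 / r) *\<^sub>R matrix_inv (X :: complex^'a^'a)"
  using assms by (intro matrix_inv_unique) (auto simp: scaleR_mult_mat mult_scaleR_mat hpd_inverse)

text \<open>Polarization: for unit vectors, 4 x.Ay is a difference of two forms that lie between 0
  and 4 c. The factor 2 comes from bounding real and imaginary part separately.\<close>

lemma loewner_entry_bound:
  fixes A :: "complex^'a^'a"
  assumes h: "cadj A = A" and "0 \<preceq> A" "A \<preceq> c *\<^sub>R mat 1"
  shows "norm (A $ i $ j) \<le> 2 * c"
proof -
  have form: "\<bar>x \<bullet> (A *v y)\<bar> \<le> c" if "norm x = 1" "norm y = 1" for x y :: "complex^'a"
  proof -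
    have "y \<bullet> (A *v x) = x \<bullet> (A *v y)"
      using inner_matrix_vector_cadj[of y A x] h by (simp add: inner_commute)
    then have pol: "4 * (x \<bullet> (A *v y)) = (x + y) \<bullet> (A *v (x + y)) - (x - y) \<bullet> (A *v (x - y))"
      by (simp add: matrix_vector_mult_diff_distrib matrix_vector_right_distrib inner_diff_left inner_diff_right
          inner_add_left inner_add_right)
    have b: "0 \<le> u \<bullet> (A *v u)" "u \<bullet> (A *v u) \<le> c * (norm u)\<^sup>2" for u
      using loewner_leD[OF assms(2), of u] loewner_leD[OF assms(3), of u]
      by (simp_all add: scaleR_mult_vec power2_norm_eq_inner)
    have "0 \<le> c" using b[of x] that by simp
    have "norm (x + y) \<le> 2" "norm (x - y) \<le> 2"
      using norm_triangle_ineq[of x y] norm_triangle_ineq4[of x y] that by auto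
    then have "(norm (x + y))\<^sup>2 \<le> 2\<^sup>2" "(norm (x - y))\<^sup>2 \<le> 2\<^sup>2"
      by (intro power_mono; simp)+
    then have "c * (norm (x + y))\<^sup>2 \<le> c * 2\<^sup>2" "c * (norm (x - y))\<^sup>2 \<le> c * 2\<^sup>2"
      using \<open>0 \<le> c\<close> by (intro mult_left_mono; simp)+
    then show ?thesis using pol b[of "x + y"] b[of "x - y"] by simp
  qed
  have Av: "A *v axis j 1 = (\<chi> k. A $ k $ j)" by (simp add: matrix_vector_mul_component axis_def matrix_vector_mult_def vec_eq_iff if_distrib cong: if_cong)
  have "\<bar>Re (A $ i $ j)\<bar> \<le> c"
    using form[of "axis i 1" "axis j 1"] by (simp add: Av inner_axis' inner_complex_def)
  \<comment> \<open>The real inner product with \<open>axis i \<i>\<close> reads off the imaginary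
    part of the entry.\<close>
  moreover have "\<bar>Im (A $ i $ j)\<bar> \<le> c"
    using form[of "axis i \<i>" "axis j 1"] by (simp add: Av inner_axis' inner_complex_def)
  ultimately show ?thesis using cmod_le[of "A $ i $ j"] by simp
qed

lemma mat_mult_diff_right: "A ** (B - C) = A ** B - A ** (C :: complex^'c^'b)"
  by (simp add: matrix_matrix_mult_def vec_eq_iff algebra_simps sum_subtractf)

lemma mat_mult_diff_left: "(A - B) ** C = A ** C - B ** (C :: complex^'c^'b)"
  by (simp add: matrix_matrix_mult_def vec_eq_iff algebra_simps sum_subtractf)

lemma mat_mult_add_left: "(A + B) ** C = A ** C + B ** (C :: complex^'c^'b)"
  by (simp add: matrix_matrix_mult_def vec_eq_iff algebra_simps sum.distrib)

section \<open>Eigenvalues of Hermitian pencils and comparison of log determinants\<close>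

lemma Im_qform:
  assumes "cadj A = A" shows "Im (qform A x) = 0"
proof -
  have "cnj (qform A x) = (\<Sum>i\<in>UNIV. \<Sum>j\<in>UNIV. cnj (x $ j) * cadj A $ j $ i * x $ i)"
    by (simp add: qform_def cadj_def mult_ac)
  also have "\<dots> = qform (cadj A) x"
    unfolding qform_def by (rule sum.swap)
  finally show ?thesis using assms by (metis cnj.sel(2) equal_neg_zero)
qed

text \<open>The eigenvalues of the pencil are those of the inverse of X times Y, so no square root of X is needed.\<close>

lemma det_hermitian_pencil:
  fixes X Y :: "complex^'n^'n"
  assumes X: "hpd X" and Y: "cadj Y = Y"
  obtains rs where "length rs = CARD('n)" "det Y = det X * complex_of_real (prod_list rs)"
    "\<And>r. r \<in> set rs \<Longrightarrow> \<exists>x. x \<noteq> 0 \<and> x \<bullet> (Y *v x) = r * (x \<bullet> (X *v x))"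
proof -
  let ?T = "matrix_inv X"
  note T = hpd_inverse[OF X]
  \<comment> \<open>The negative is factored, so that \<open>z = 0\<close> yields the determinant of
    \<open>?T ** Y\<close> itself; its eigenvalues are the numbers \<open>- a\<close>.\<close>
  obtain as where len: "length as = CARD('n)"
    and as: "\<And>z. det (mat z - (- (?T ** Y))) = (\<Prod>a\<leftarrow>as. z - a)"
    using det_shift_factorization[of "- (?T ** Y)"] by blast
  have root: "Im a = 0 \<and> (\<exists>x. x \<noteq> 0 \<and> x \<bullet> (Y *v x) = Re (- a) * (x \<bullet> (X *v x)))" if "a \<in> set as" for a
  proof -
    have "(\<Prod>b\<leftarrow>as. a - b) = 0"
      using that by (auto simp: prod_list_zero_iff)
    then have "det (mat a + ?T ** Y) = 0"
      using as[of a] by simp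
    then have "\<not> invertible (mat a + ?T ** Y)" by (simp add: invertible_det_nz)
    then obtain x where x: "x \<noteq> 0" "(mat a + ?T ** Y) *v x = 0"
      by (metis invertible_left_inverse matrix_left_invertible_ker)
    have "0 = X *v ((mat a + ?T ** Y) *v x)" using x by simp
    also have "\<dots> = (X ** (mat a + ?T ** Y)) *v x"
      by (rule matrix_vector_mul_assoc)
    also have "\<dots> = (X ** mat a) *v x + (X ** ?T ** Y) *v x"
      by (simp add: matrix_add_ldistrib matrix_vector_mult_add_rdistrib matrix_mul_assoc)
    also have "X ** mat a = (\<chi> i j. a * X $ i $ j)"
      by (simp add: matrix_matrix_mult_def mat_def vec_eq_iff if_distrib mult.commute cong: if_cong)
    finally have "Y *v x = - ((\<chi> i j. a * X $ i $ j) *v x)"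
      by (simp add: T eq_neg_iff_add_eq_0 add.commute)
    moreover have "(\<chi> i j. a * X $ i $ j) *v x = (\<chi> i. a * (X *v x) $ i)"
      by (simp add: matrix_vector_mult_def vec_eq_iff sum_distrib_left mult_ac)
    ultimately have "qform Y x = - a * qform X x"
      by (simp add: qform_eq_sum_mult sum_distrib_left sum_negf mult_ac)
    \<comment> \<open>Both forms are real and that of \<open>X\<close> is positive, which forces
      \<open>a\<close> to be real.\<close>
    moreover have "0 < Re (qform X x)" using X x by (simp add: hpd_def)
    moreover have "Im (qform X x) = 0" "Im (qform Y x) = 0"
      using Im_qform X Y by (auto simp: hpd_def)
    ultimately show ?thesis
      using x(1) by (auto simp: Re_qform[symmetric] intro!: exI[of _ x])
  qed
  define rs where "rs = map (\<lambda>a. Re (- a)) as"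
  have "(\<Prod>a\<leftarrow>as. 0 - a) = (\<Prod>a\<leftarrow>as. complex_of_real (Re (- a)))"
    using root by (intro arg_cong[of _ _ prod_list] map_cong refl) (auto simp: complex_eq_iff)
  also have "\<dots> = complex_of_real (prod_list rs)"
    unfolding rs_def by (induction as) auto
  finally have p: "det (?T ** Y) = complex_of_real (prod_list rs)"
    using as[of 0] by (simp add: mat_0)
  have "Y = X ** (?T ** Y)" by (simp add: matrix_mul_assoc T)
  then have "det Y = det X * complex_of_real (prod_list rs)"
    using p det_mul[of X "?T ** Y"] by simp
  then show ?thesis
  proof (rule that[rotated])
    show "length rs = CARD('n)" by (simp add: rs_def len)
    show "\<exists>x. x \<noteq> 0 \<and> x \<bullet> (Y *v x) = r * (x \<bullet> (X *v x))" if "r \<in> set rs" for r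
      using that root by (auto simp: rs_def)
  qed
qed

lemma prod_list_ge_power:
  assumes "0 \<le> t" "\<And>r. r \<in> set rs \<Longrightarrow> t \<le> r"
  shows "t ^ length rs \<le> prod_list (rs :: real list)"
  using assms
proof (induction rs)
  case (Cons a rs)
  then have "t * t ^ length rs \<le> a * prod_list rs" by (intro mult_mono) (auto intro: order_trans)
  then show ?case by simp
qed simp

text \<open>The pencil of \<open>Y\<close> with the identity has only positive roots. Hence
  \<open>ldet\<close>, which takes \<open>ln\<close> of a real part, is the true logarithm of the
  determinant.\<close>

lemma det_hpd:
  assumes "hpd (Y :: complex^'n^'n)"
  shows "det Y = complex_of_real (Re (det Y))" "0 < Re (det Y)"
proof -
  have "cadj Y = Y" using assms by (simp add: hpd_def)
  from det_hermitian_pencil[OF hpd_one this]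
  obtain rs where rs: "det Y = complex_of_real (prod_list rs)"
    and r: "\<And>r. r \<in> set rs \<Longrightarrow> \<exists>x. x \<noteq> 0 \<and> x \<bullet> (Y *v x) = r * (x \<bullet> x)"
    by (metis det_I matrix_vector_mul_lid mult_1)
  have "0 < r" if rr: "r \<in> set rs" for r
  proof -
    obtain x where x: "x \<noteq> 0" "x \<bullet> (Y *v x) = r * (x \<bullet> x)" using r[OF rr] by blast
    then have "0 < r * (x \<bullet> x)" using assms by (metis hpd_iff)
    then show ?thesis using x(1) by (metis inner_gt_zero_iff zero_less_mult_pos2)
  qed
  then have "0 < prod_list rs" by (induction rs) auto
  then show "det Y = complex_of_real (Re (det Y))" "0 < Re (det Y)" using rs by auto
qed

text \<open>Every root of the pencil of \<open>Y\<close> and \<open>X\<close> is at least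
  \<open>t\<close>, and there are \<open>CARD('n)\<close> of them. This is the passage from a
  multiplicative order relation to a difference of log determinants free of any norm of
  \<open>X\<close> or \<open>Y\<close>.\<close>

lemma ldet_ge:
  fixes X Y :: "complex^'n^'n"
  assumes X: "hpd X" and Y: "hpd Y" and t: "0 < t" and le: "t *\<^sub>R X \<preceq> Y"
  shows "CARD('n) * ln t + ldet X \<le> ldet Y"
proof -
  obtain rs where len: "length rs = CARD('n)" and d: "det Y = det X * complex_of_real (prod_list rs)"
    and r: "\<And>r. r \<in> set rs \<Longrightarrow> \<exists>x. x \<noteq> 0 \<and> x \<bullet> (Y *v x) = r * (x \<bullet> (X *v x))"
    using det_hermitian_pencil[OF X, of Y] Y by (auto simp: hpd_iff)
  have "t \<le> r" if rr: "r \<in> set rs" for r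
  proof -
    obtain x where x: "x \<noteq> 0" "x \<bullet> (Y *v x) = r * (x \<bullet> (X *v x))" using r[OF rr] by blast
    moreover have "0 < x \<bullet> (X *v x)" using X x(1) by (simp add: hpd_iff)
    ultimately show ?thesis using loewner_leD[OF le, of x] by (simp add: scaleR_mult_vec)
  qed
  then have p: "t ^ CARD('n) \<le> prod_list rs" using prod_list_ge_power[of t rs] t len by simp
  have "CARD('n) * ln t + ldet X = ln (t ^ CARD('n) * Re (det X))"
    using t det_hpd[OF X] by (simp add: ldet_def ln_mult ln_realpow)
  also have "\<dots> \<le> ln (prod_list rs * Re (det X))"
    using p t det_hpd[OF X] by (intro ln_mono mult_right_mono) auto
  also have "\<dots> = ldet Y"
    unfolding ldet_def d by (subst det_hpd(1)[OF X]) (simp add: mult.commute)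
  finally show ?thesis .
qed

lemma ldet_one [simp]: "ldet (mat 1) = 0"
  by (simp add: ldet_def)

section \<open>The recursion map: a priori bounds, contraction, Woodbury's identity\<close>

lemma hpd_add_one: "hpsd A \<Longrightarrow> 0 \<le> r \<Longrightarrow> hpd (mat 1 + r *\<^sub>R A)"
  by (simp add: hpd_add_hpsd hpsd_scaleR)

lemma hpsd_conj_cadj: "hpsd A \<Longrightarrow> hpsd (cadj G ** A ** G)"
  using hpsd_conj[of A "cadj G"] by simp

lemma loewner_conj_cadj_mono: "A \<preceq> B \<Longrightarrow> cadj G ** A ** G \<preceq> cadj G ** B ** G"
  using loewner_conj_mono[of A B "cadj G"] by simp

lemma loewner_one_add: "hpsd A \<Longrightarrow> 0 \<le> r \<Longrightarrow> mat 1 \<preceq> mat 1 + r *\<^sub>R A"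
  by (simp add: loewner_le_def hpsd_iff matrix_vector_mult_add_rdistrib scaleR_mult_vec inner_add_right)

abbreviation inner_mat :: "real \<Rightarrow> complex^'k^'n \<Rightarrow> complex^'k^'k \<Rightarrow> complex^'n^'n" where
  "inner_mat \<rho> F W \<equiv> mat 1 + \<rho> *\<^sub>R (F ** W ** cadj F)"

abbreviation outer_mat :: "real \<Rightarrow> complex^'k^'n \<Rightarrow> complex^'k^'n \<Rightarrow> complex^'k^'k \<Rightarrow> complex^'k^'k" where
  "outer_mat \<rho> F G W \<equiv> mat 1 + \<rho> *\<^sub>R (cadj G ** matrix_inv (inner_mat \<rho> F W) ** G)"

lemma hpd_inner_mat: "hpsd W \<Longrightarrow> 0 \<le> \<rho> \<Longrightarrow> hpd (inner_mat \<rho> F W)"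
  by (intro hpd_add_one hpsd_conj)

lemma hpd_outer_mat: "hpsd W \<Longrightarrow> 0 \<le> \<rho> \<Longrightarrow> hpd (outer_mat \<rho> F G W)"
  by (intro hpd_add_one hpsd_conj_cadj hpd_imp_hpsd[OF hpd_matrix_inv[OF hpd_inner_mat]])

lemma hpd_Wmap: "hpsd W \<Longrightarrow> 0 \<le> \<rho> \<Longrightarrow> hpd (Wmap \<rho> F G W)"
  unfolding Wmap_def by (intro hpd_matrix_inv hpd_outer_mat)

lemma Wmap_le_one:
  assumes "hpsd W" "0 \<le> \<rho>" shows "Wmap \<rho> F G W \<preceq> mat 1"
proof -
  have "mat 1 \<preceq> outer_mat \<rho> F G W"
    using assms by (intro loewner_one_add hpsd_conj_cadj hpd_imp_hpsd[OF hpd_matrix_inv[OF hpd_inner_mat]])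
  then show ?thesis
    unfolding Wmap_def using matrix_inv_antimono[OF hpd_one hpd_outer_mat[OF assms]] by simp
qed

lemma inner_mat_le:
  assumes "W \<preceq> mat 1" "0 \<le> \<rho>"
  shows "inner_mat \<rho> F W \<preceq> (1 + \<rho> * (norm F)\<^sup>2) *\<^sub>R mat 1"
  using loewner_add_mono[OF loewner_refl loewner_scaleR_mono[OF loewner_conj_norm[OF assms(1), of F] assms(2)], of "mat 1"]
  by (simp add: scaleR_add_left)

lemma outer_mat_le:
  assumes "hpsd W" "0 \<le> \<rho>"
  shows "outer_mat \<rho> F G W \<preceq> (1 + \<rho> * (norm G)\<^sup>2) *\<^sub>R mat 1"
proof -
  have "mat 1 \<preceq> inner_mat \<rho> F W"
    using assms by (intro loewner_one_add hpsd_conj)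
  then have "matrix_inv (inner_mat \<rho> F W) \<preceq> mat 1"
    using matrix_inv_antimono[OF hpd_one hpd_inner_mat[OF assms]] by simp
  from loewner_conj_norm[OF this, of "cadj G"]
  have "\<rho> *\<^sub>R (cadj G ** matrix_inv (inner_mat \<rho> F W) ** G) \<preceq> \<rho> *\<^sub>R (norm G)\<^sup>2 *\<^sub>R mat 1"
    by (intro loewner_scaleR_mono) (use assms in \<open>simp_all add: norm_cadj\<close>)
  from loewner_add_mono[OF loewner_refl[of "mat 1"] this] show ?thesis
    by (simp add: scaleR_add_left)
qed

lemma Wmap_ge:
  fixes F G :: "complex^'k^'n"
  assumes "hpsd W" "0 \<le> \<rho>"
  shows "(1 / (1 + \<rho> * (norm G)\<^sup>2)) *\<^sub>R mat 1 \<preceq> Wmap \<rho> F G W"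
proof -
  have p: "0 < 1 + \<rho> * (norm G)\<^sup>2" using assms by (simp add: add_pos_nonneg)
  show ?thesis
    using matrix_inv_antimono[OF hpd_outer_mat[OF assms] hpd_scaleR[OF hpd_one p] outer_mat_le[OF assms], of F] p
      matrix_inv_scaleR[OF hpd_one[where 'a='k], of "1 + \<rho> * (norm G)\<^sup>2"]
    unfolding Wmap_def by simp
qed

text \<open>The order bounds become bounds by |F|^2 through ln (1 + x) \<le> x. In this form the
  second moments dominate all increments.\<close>

lemma ldetF_bounds:
  fixes F :: "complex^'k^'n"
  assumes "hpsd W" "W \<preceq> mat 1" "0 \<le> \<rho>"
  shows "0 \<le> ldetF \<rho> F W" "ldetF \<rho> F W \<le> CARD('n) * (\<rho> * (norm F)\<^sup>2)"
proof -
  let ?c = "1 + \<rho> * (norm F)\<^sup>2"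
  have c: "0 < ?c" using assms by (simp add: add_pos_nonneg)
  note A = hpd_inner_mat[OF assms(1,3), of F]
  show "0 \<le> ldetF \<rho> F W"
    using ldet_ge[OF hpd_one A, of 1] loewner_one_add[OF hpsd_conj[OF assms(1), of F] assms(3)] by (simp add: ldetF_def)
  have "(1 / ?c) *\<^sub>R inner_mat \<rho> F W \<preceq> mat 1"
    using loewner_scaleR_mono[OF inner_mat_le[OF assms(2,3), of F], of "1 / ?c"] c by simp
  from ldet_ge[OF A hpd_one _ this] c have "ldetF \<rho> F W \<le> CARD('n) * ln ?c"
    by (simp add: ldetF_def ln_div)
  also have "\<dots> \<le> CARD('n) * (\<rho> * (norm F)\<^sup>2)"
    using assms by (intro mult_left_mono ln_add_one_self_le_self) auto
  finally show "ldetF \<rho> F W \<le> CARD('n) * (\<rho> * (norm F)\<^sup>2)" .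
qed

lemma ldet_Wmap_bounds:
  fixes G :: "complex^'k^'n"
  assumes "hpsd W" "0 \<le> \<rho>"
  shows "ldet (Wmap \<rho> F G W) \<le> 0" "- (CARD('k) * (\<rho> * (norm G)\<^sup>2)) \<le> ldet (Wmap \<rho> F G W)"
proof -
  let ?c = "1 + \<rho> * (norm G)\<^sup>2"
  have c: "0 < ?c" using assms by (simp add: add_pos_nonneg)
  note W = hpd_Wmap[OF assms, of F G]
  show "ldet (Wmap \<rho> F G W) \<le> 0"
    using ldet_ge[OF W hpd_one, of 1] Wmap_le_one[OF assms, of F G] by simp
  have "CARD('k) * ln ?c \<le> CARD('k) * (\<rho> * (norm G)\<^sup>2)"
    using assms by (intro mult_left_mono ln_add_one_self_le_self) auto
  moreover have "- (CARD('k) * ln ?c) \<le> ldet (Wmap \<rho> F G W)"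
    using ldet_ge[OF hpd_one W _ Wmap_ge[OF assms]] c by (simp add: ln_div)
  ultimately show "- (CARD('k) * (\<rho> * (norm G)\<^sup>2)) \<le> ldet (Wmap \<rho> F G W)" by linarith
qed

text \<open>For X \<preceq> 1 the matrix \<open>inner_mat \<rho> F X\<close> is at most 1 + \<rho>
  |F|^2 times the identity, so its summand 1 makes up at least the fraction 1 / (1 + \<rho> |F|^2) =
  1 - q of it. This part is common to all orbits and not subject to the factor t.\<close>

definition contr :: "real \<Rightarrow> complex^'k^'n \<Rightarrow> real" where
  "contr \<rho> F = \<rho> * (norm F)\<^sup>2 / (1 + \<rho> * (norm F)\<^sup>2)"

lemma contr_bounds: "0 \<le> \<rho> \<Longrightarrow> 0 \<le> contr \<rho> F" "0 \<le> \<rho> \<Longrightarrow> contr \<rho> F < 1"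
  by (auto simp: contr_def divide_simps add_pos_nonneg)

text \<open>Let n and a be the forms of the identity and of \<open>F ** X ** cadj F\<close> at
  \<open>v\<close>. The difference to be shown nonnegative is at least (1 - t) (q n - (1 - q) \<rho>
  a). This vanishes in the extreme case a = |F|^2 n, which fixes the value of q.\<close>

lemma inner_mat_contraction:
  fixes F :: "complex^'k^'n"
  assumes X: "X \<preceq> mat 1" and le: "t *\<^sub>R X \<preceq> Y" and t: "t \<le> 1" and \<rho>: "0 \<le> \<rho>"
  shows "(1 - (1 - t) * contr \<rho> F) *\<^sub>R inner_mat \<rho> F X \<preceq> inner_mat \<rho> F Y"
  unfolding loewner_le_def
proof
  fix v :: "complex^'n"
  let ?x = "(norm F)\<^sup>2" and ?n = "v \<bullet> v"
  define a where "a = v \<bullet> ((F ** X ** cadj F) *v v)"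
  define b where "b = v \<bullet> ((F ** Y ** cadj F) *v v)"
  have tab: "t * a \<le> b"
    using loewner_leD[OF loewner_conj_mono[OF le], of v F]
    by (simp add: a_def b_def scaleR_mult_mat mult_scaleR_mat scaleR_mult_vec)
  have an: "a \<le> ?x * ?n"
    using loewner_leD[OF loewner_conj_norm[OF X], of v F] by (simp add: a_def scaleR_mult_vec)
  have p: "0 < 1 + \<rho> * ?x" using \<rho> by (simp add: add_pos_nonneg)
  have "(1 - t) * (\<rho> * a) \<le> (1 - t) * (\<rho> * (?x * ?n))"
    using an t \<rho> by (intro mult_left_mono) auto
  then have "(1 - t) * (\<rho> * a) / (1 + \<rho> * ?x) \<le> (1 - t) * (\<rho> * (?x * ?n)) / (1 + \<rho> * ?x)"
    using p by (intro divide_right_mono) auto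
  moreover have "1 - contr \<rho> F = 1 / (1 + \<rho> * ?x)" using p by (simp add: contr_def field_simps)
  ultimately have "(1 - t) * (1 - contr \<rho> F) * (\<rho> * a) \<le> (1 - t) * contr \<rho> F * ?n"
    by (simp add: contr_def mult_ac)
  moreover have "\<rho> * (t * a) \<le> \<rho> * b" using tab \<rho> by (rule mult_left_mono)
  ultimately have "(1 - (1 - t) * contr \<rho> F) * (?n + \<rho> * a) \<le> ?n + \<rho> * b"
    by (simp add: algebra_simps)
  then show "v \<bullet> (((1 - (1 - t) * contr \<rho> F) *\<^sub>R inner_mat \<rho> F X) *v v) \<le> v \<bullet> (inner_mat \<rho> F Y *v v)"
    by (simp add: a_def b_def scaleR_mult_vec matrix_vector_mult_add_rdistrib inner_add_right)
qed

text \<open>Positivity holds even at \<open>t = 0\<close>, where orbit comparisons start, because q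
  is strictly below 1; the factor can therefore be inverted from the first step on.\<close>

lemma contr_factor_bounds:
  assumes "0 \<le> t" "t \<le> 1" "0 \<le> \<rho>"
  shows "0 < 1 - (1 - t) * contr \<rho> F" "1 - (1 - t) * contr \<rho> F \<le> 1"
proof -
  have "(1 - t) * contr \<rho> F \<le> 1 * contr \<rho> F"
    using assms contr_bounds by (intro mult_right_mono) auto
  then show "0 < 1 - (1 - t) * contr \<rho> F" using contr_bounds(2)[OF assms(3), of F] by simp
  show "1 - (1 - t) * contr \<rho> F \<le> 1"
    using assms contr_bounds(1)[OF assms(3), of F] by (simp add: mult_nonneg_nonneg)
qed

text \<open>The factor improves only inside \<open>inner_mat\<close>. Inversion turns s into 1 / s,
  adding the identity keeps 1 / s because it is at least 1, and the outer inversion returns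
  s.\<close>

lemma Wmap_contraction:
  fixes F G :: "complex^'k^'n"
  assumes X: "hpsd X" "X \<preceq> mat 1" and Y: "hpsd Y" and le: "t *\<^sub>R X \<preceq> Y"
    and t: "0 \<le> t" "t \<le> 1" and \<rho>: "0 \<le> \<rho>"
  shows "(1 - (1 - t) * contr \<rho> F) *\<^sub>R Wmap \<rho> F G X \<preceq> Wmap \<rho> F G Y"
proof -
  define s where "s = 1 - (1 - t) * contr \<rho> F"
  have s: "0 < s" "s \<le> 1" using contr_factor_bounds[OF t \<rho>, of F] by (auto simp: s_def)
  note AX = hpd_inner_mat[OF X(1) \<rho>, of F] and AY = hpd_inner_mat[OF Y \<rho>, of F]
  have "s *\<^sub>R inner_mat \<rho> F X \<preceq> inner_mat \<rho> F Y"
    unfolding s_def by (rule inner_mat_contraction[OF X(2) le t(2) \<rho>])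
  from matrix_inv_antimono[OF hpd_scaleR[OF AX s(1)] AY this]
  have "matrix_inv (inner_mat \<rho> F Y) \<preceq> (1 / s) *\<^sub>R matrix_inv (inner_mat \<rho> F X)"
    using matrix_inv_scaleR[OF AX] s by simp
  from loewner_scaleR_mono[OF loewner_conj_cadj_mono[OF this, of G] \<rho>]
  have "\<rho> *\<^sub>R (cadj G ** matrix_inv (inner_mat \<rho> F Y) ** G) \<preceq> (1 / s) *\<^sub>R \<rho> *\<^sub>R (cadj G ** matrix_inv (inner_mat \<rho> F X) ** G)"
    by (simp add: scaleR_mult_mat mult_scaleR_mat mult.commute)
  moreover have "mat 1 \<preceq> (1 / s) *\<^sub>R (mat 1 :: complex^'k^'k)"
    using loewner_scaleR_left_mono[OF hpsd_one, of 1 "1 / s"] s by simp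
  ultimately have "outer_mat \<rho> F G Y \<preceq> (1 / s) *\<^sub>R outer_mat \<rho> F G X"
    unfolding scaleR_add_right by (intro loewner_add_mono)
  from matrix_inv_antimono[OF hpd_outer_mat[OF Y \<rho>] hpd_scaleR[OF hpd_outer_mat[OF X(1) \<rho>]] this]
  show ?thesis
    using s matrix_inv_scaleR[OF hpd_outer_mat[OF X(1) \<rho>, of G F], of "1 / s"] by (simp add: Wmap_def s_def)
qed

lemma Wmap_mono:
  assumes "hpsd X" "X \<preceq> mat 1" "hpsd Y" "X \<preceq> Y" "0 \<le> \<rho>"
  shows "Wmap \<rho> F G X \<preceq> Wmap \<rho> F G Y"
  using Wmap_contraction[of X Y 1 \<rho> F G] assms by simp

text \<open>\<open>S\<close> is the pivot met in the block elimination. The identity rests on the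
  resolvent equation P - T = P (S - A) T for the inverses P of A =
  \<open>inner_mat \<rho> F W\<close> and T of \<open>S\<close>.\<close>

lemma Wmap_woodbury:
  fixes F G :: "complex^'k^'n"
  assumes W: "hpsd W" and \<rho>: "0 \<le> \<rho>"
  defines "S \<equiv> inner_mat \<rho> F W + \<rho> *\<^sub>R (G ** cadj G)"
  shows "Wmap \<rho> F G W = mat 1 - cadj G ** matrix_inv S ** (\<rho> *\<^sub>R G)"
proof -
  let ?P = "matrix_inv (inner_mat \<rho> F W)" and ?T = "matrix_inv S"
  note A = hpd_inner_mat[OF W \<rho>, of F]
  have "hpsd (G ** cadj G)" using hpsd_conj[OF hpsd_one, of G] by simp
  then have S: "hpd S" unfolding S_def using \<rho> by (intro hpd_add_hpsd[OF A] hpsd_scaleR)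
  have "?P ** (\<rho> *\<^sub>R (G ** cadj G)) ** ?T = ?P ** (S - inner_mat \<rho> F W) ** ?T" by (simp add: S_def)
  also have "\<dots> = ?P ** (S ** ?T) - (?P ** inner_mat \<rho> F W) ** ?T"
    by (simp add: mat_mult_diff_right mat_mult_diff_left matrix_mul_assoc)
  also have "\<dots> = ?P - ?T" by (simp only: hpd_inverse[OF A] hpd_inverse[OF S] matrix_mul_lid matrix_mul_rid)
  finally have PT: "\<rho> *\<^sub>R (?P ** G ** cadj G ** ?T) = ?P - ?T"
    by (simp add: scaleR_mult_mat mult_scaleR_mat matrix_mul_assoc)
  have "cadj G ** ?P ** G ** (cadj G ** ?T ** (\<rho> *\<^sub>R G)) = cadj G ** (\<rho> *\<^sub>R (?P ** G ** cadj G ** ?T)) ** G"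
    by (simp add: scaleR_mult_mat mult_scaleR_mat matrix_mul_assoc)
  also have "\<dots> = cadj G ** ?P ** G - cadj G ** ?T ** G"
    unfolding PT by (simp add: mat_mult_diff_right mat_mult_diff_left)
  finally have "outer_mat \<rho> F G W ** (mat 1 - cadj G ** ?T ** (\<rho> *\<^sub>R G)) = mat 1"
    by (simp add: mat_mult_diff_right mat_mult_add_left scaleR_mult_mat mult_scaleR_mat scaleR_diff_right)
  then show ?thesis
    unfolding Wmap_def using matrix_left_right_inverse by (intro matrix_inv_unique) blast+
qed

text \<open>Splits the pivot determinant into the two terms of an increment: its logarithm is
  \<open>ldetF\<close> minus \<open>ldet\<close> of the next matrix.\<close>

lemma det_Wmap_exchange:
  assumes W: "hpsd W" and \<rho>: "0 \<le> \<rho>"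
  shows "det (inner_mat \<rho> F W + \<rho> *\<^sub>R (G ** cadj G)) * det (Wmap \<rho> F G W) = det (inner_mat \<rho> F W)"
proof -
  let ?S = "inner_mat \<rho> F W + \<rho> *\<^sub>R (G ** cadj G)"
  have "hpsd (G ** cadj G)" using hpsd_conj[OF hpsd_one, of G] by simp
  then have S: "hpd ?S" using \<rho> by (intro hpd_add_hpsd[OF hpd_inner_mat[OF W \<rho>]] hpsd_scaleR)
  show ?thesis
    unfolding Wmap_woodbury[OF assms]
    using det_schur_complement_exchange[OF hpd_inverse[OF S], of "cadj G" "\<rho> *\<^sub>R G"] by (simp add: scaleR_mult_mat)
qed

section \<open>Block Gaussian elimination\<close>

lemma det_hpd_exp: "hpd Y \<Longrightarrow> det Y = complex_of_real (exp (ldet Y))"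
  using det_hpd[of Y] by (simp add: ldet_def)

text \<open>\<open>Xseq\<close> is built at its last step whereas elimination starts from the first,
  so the first step is split off here.\<close>

lemma Xseq_Suc_shift:
  "Xseq \<rho> F G W (Suc j) = Xseq \<rho> (\<lambda>i. F (1 + i)) (\<lambda>i. G (1 + i)) (Wmap \<rho> (F 0) (G 0) W) j"
  by (induction j) simp_all

text \<open>Block tridiagonal Gram matrix, with the identity between the first F and its adjoint replaced by W.
  Eliminating the first block row reproduces this shape with W replaced by its image under the recursion.\<close>

definition gram_block ::
  "real \<Rightarrow> (int \<Rightarrow> complex^'k^'n) \<Rightarrow> (int \<Rightarrow> complex^'k^'n) \<Rightarrow> complex^'k^'k \<Rightarrow> nat \<Rightarrow> nat \<Rightarrow> complex^'n^'n" where
  "gram_block \<rho> F G W i j =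
     (if i = j then inner_mat \<rho> (F (int i)) (if i = 0 then W else mat 1) + \<rho> *\<^sub>R (G (int i) ** cadj (G (int i)))
      else if j = Suc i then \<rho> *\<^sub>R (G (int i) ** cadj (F (int j)))
      else if i = Suc j then \<rho> *\<^sub>R (F (int i) ** cadj (G (int j))) else 0)"

lemma bdet_gram_block_Suc:
  fixes F G :: "int \<Rightarrow> complex^'k^'n"
  assumes W: "hpsd W" and \<rho>: "0 \<le> \<rho>"
  shows "bdet (Suc L) (gram_block \<rho> F G W) = complex_of_real (exp (ldetF \<rho> (F 0) W - ldet (Wmap \<rho> (F 0) (G 0) W)))
     * bdet L (gram_block \<rho> (\<lambda>i. F (1 + i)) (\<lambda>i. G (1 + i)) (Wmap \<rho> (F 0) (G 0) W))"
proof -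
  let ?S = "inner_mat \<rho> (F 0) W + \<rho> *\<^sub>R (G 0 ** cadj (G 0))"
  let ?W' = "Wmap \<rho> (F 0) (G 0) W" and ?B = "gram_block \<rho> F G W"
  have "hpsd (G 0 ** cadj (G 0))" using hpsd_conj[OF hpsd_one, of "G 0"] by simp
  then have S: "hpd ?S" using \<rho> by (intro hpd_add_hpsd[OF hpd_inner_mat[OF W \<rho>]] hpsd_scaleR)
  have B00: "?B 0 0 = ?S" by (simp add: gram_block_def)
  \<comment> \<open>Blocks couple only to their neighbours, so row and column 0 vanish beyond index
    1 and only the block at (1, 1) changes.\<close>
  have elim: "?B (Suc i) (Suc j) - ?B (Suc i) 0 ** matrix_inv ?S ** ?B 0 (Suc j)
      = gram_block \<rho> (\<lambda>i. F (1 + i)) (\<lambda>i. G (1 + i)) ?W' i j" for i j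
  proof (cases "i = 0 \<and> j = 0")
    case True
    \<comment> \<open>Woodbury's identity recognizes the Schur correction, which passes through
      \<open>G 0\<close>, as the change from the identity to the next matrix between
      \<open>F 1\<close> and its adjoint.\<close>
    have "F 1 ** ?W' ** cadj (F 1) = F 1 ** cadj (F 1) - \<rho> *\<^sub>R (F 1 ** cadj (G 0) ** matrix_inv ?S ** (G 0) ** cadj (F 1))"
      unfolding Wmap_woodbury[OF W \<rho>]
      by (simp add: mat_mult_diff_right mat_mult_diff_left scaleR_mult_mat mult_scaleR_mat matrix_mul_assoc)
    then show ?thesis
      using True by (simp add: gram_block_def scaleR_mult_mat mult_scaleR_mat matrix_mul_assoc scaleR_diff_right)
  next
    case False
    then have "?B (Suc i) 0 = 0 \<or> ?B 0 (Suc j) = 0" by (auto simp: gram_block_def)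
    then show ?thesis using False by (auto simp: gram_block_def)
  qed
  have "bdet (Suc L) ?B = det ?S * bdet L (\<lambda>i j. ?B (Suc i) (Suc j) - ?B (Suc i) 0 ** matrix_inv ?S ** ?B 0 (Suc j))"
    using bdet_Suc[of ?B "matrix_inv ?S" L] hpd_inverse[OF S] by (simp add: B00)
  moreover have "det ?S = complex_of_real (exp (ldetF \<rho> (F 0) W - ldet ?W'))"
  proof -
    have "det ?S * det ?W' = det (inner_mat \<rho> (F 0) W)" by (rule det_Wmap_exchange[OF W \<rho>])
    then show ?thesis
      using det_hpd_exp[OF hpd_Wmap[OF W \<rho>, of "F 0" "G 0"]] det_hpd_exp[OF hpd_inner_mat[OF W \<rho>, of "F 0"]]
      by (simp add: ldetF_def exp_diff field_simps)
  qed
  ultimately show ?thesis by (simp only: elim)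
qed

lemma bdet_gram_block:
  assumes "hpsd W" "0 \<le> \<rho>"
  shows "bdet L (gram_block \<rho> F G W) = complex_of_real (exp (\<Sum>j<L.
    ldetF \<rho> (F (int j)) (Xseq \<rho> F G W j) - ldet (Xseq \<rho> F G W (Suc j))))"
  using assms
proof (induction L arbitrary: F G W)
  case (Suc L)
  have W': "hpsd (Wmap \<rho> (F 0) (G 0) W)" using Suc.prems by (intro hpd_imp_hpsd[OF hpd_Wmap])
  have "bdet L (gram_block \<rho> (\<lambda>i. F (1 + i)) (\<lambda>i. G (1 + i)) (Wmap \<rho> (F 0) (G 0) W)) =
    complex_of_real (exp (\<Sum>j<L. ldetF \<rho> (F (int (Suc j))) (Xseq \<rho> F G W (Suc j)) - ldet (Xseq \<rho> F G W (Suc (Suc j)))))"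
    unfolding Suc.IH[OF W' Suc.prems(2)] Xseq_Suc_shift[symmetric] by simp
  then show ?case
    unfolding bdet_gram_block_Suc[OF Suc.prems] sum.lessThan_Suc_shift[of _ L]
    by (simp add: exp_add)
qed (simp add: bdet_0)

lemma sum_lessThan_mult: "(\<Sum>c<L * k. f (c div k) (c mod k)) = (\<Sum>j<L. \<Sum>b<k. f j b :: complex)" if "0 < k" for L k :: nat
proof -
  have "(\<Sum>c<L * k. f (c div k) (c mod k)) = (\<Sum>j<L. \<Sum>c=j * k..<j * k + k. f (c div k) (c mod k))"
    by (rule sum.nat_group[symmetric])
  also have "\<dots> = (\<Sum>j<L. \<Sum>b<k. f j b)"
  proof (rule sum.cong[OF refl])
    fix j
    have "(\<Sum>c=j * k..<j * k + k. f (c div k) (c mod k)) = (\<Sum>b=0..<k. f ((b + j * k) div k) ((b + j * k) mod k))"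
      using sum.shift_bounds_nat_ivl[of "\<lambda>c. f (c div k) (c mod k)" 0 "j * k" k] by (simp add: add.commute)
    also have "\<dots> = (\<Sum>b<k. f j b)" using that by (auto simp: atLeast0LessThan intro!: sum.cong)
    finally show "(\<Sum>c=j * k..<j * k + k. f (c div k) (c mod k)) = (\<Sum>b<k. f j b)" .
  qed
  finally show ?thesis .
qed

text \<open>For \<open>W = mat 1\<close> the first diagonal block has the same shape as all others.
  This is why the elimination for H runs the recursion from the identity.\<close>

lemma det_nat_Hmat:
  fixes F G :: "int \<Rightarrow> complex^'k^'n"
  shows "det_nat (L * CARD('n)) (\<lambda>r r'. (if r = r' then 1 else 0) +
          complex_of_real \<rho> * (\<Sum>c<Suc L * CARD('k). Hmat F G m r c * cnj (Hmat F G m r' c)))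
    = bdet L (gram_block \<rho> (\<lambda>i. F (m + i)) (\<lambda>i. G (m + i)) (mat 1))"
proof -
  let ?N = "CARD('n)" and ?K = "CARD('k)"
  define H where "H i j = (if j = i then F (m + int i) else if j = Suc i then G (m + int i) else 0)" for i j
  have Hmat: "Hmat F G m r c = ent (H (r div ?N) (c div ?K)) (r mod ?N) (c mod ?K)" for r c
    by (simp add: Hmat_def H_def Let_def ent_def)
  have gram: "gram_block \<rho> (\<lambda>i. F (m + i)) (\<lambda>i. G (m + i)) (mat 1) i i'
      = (if i = i' then mat 1 else 0) + \<rho> *\<^sub>R (\<Sum>j<Suc L. H i j ** cadj (H i' j))" if "i < L" "i' < L" for i i'
  proof -
    \<comment> \<open>Block row i occupies the block columns i and i + 1 only, and i < L puts both
      among the \<open>Suc L\<close> available ones.\<close>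
    have "(\<Sum>j<Suc L. H i j ** cadj (H i' j)) = (\<Sum>j\<in>{i, Suc i}. H i j ** cadj (H i' j))"
      using that by (intro sum.mono_neutral_right) (auto simp: H_def)
    then show ?thesis by (auto simp: gram_block_def H_def scaleR_add_right)
  qed
  have entry: "(if r = r' then 1 else 0) + complex_of_real \<rho> * (\<Sum>c<Suc L * ?K. Hmat F G m r c * cnj (Hmat F G m r' c))
    = ent (gram_block \<rho> (\<lambda>i. F (m + i)) (\<lambda>i. G (m + i)) (mat 1) (r div ?N) (r' div ?N)) (r mod ?N) (r' mod ?N)"
    if r: "r < L * ?N" "r' < L * ?N" for r r'
  proof -
    have scale: "complex_of_real \<rho> * ent S a b = ent (\<rho> *\<^sub>R S) a b" for S :: "complex^'n^'n" and a b
      by (simp add: ent_def) (simp add: scaleR_conv_of_real)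
    have lt: "r div ?N < L" "r' div ?N < L" using r by (simp_all add: less_mult_imp_div_less)
    have "(\<Sum>c<Suc L * ?K. Hmat F G m r c * cnj (Hmat F G m r' c))
      = (\<Sum>j<Suc L. \<Sum>b<?K. ent (H (r div ?N) j) (r mod ?N) b * cnj (ent (H (r' div ?N) j) (r' mod ?N) b))"
      unfolding Hmat by (rule sum_lessThan_mult) simp
    also have "\<dots> = ent (\<Sum>j<Suc L. H (r div ?N) j ** cadj (H (r' div ?N) j)) (r mod ?N) (r' mod ?N)"
      by (simp add: ent_def cadj_def matrix_matrix_mult_def sum_enum_ix[symmetric])
    finally have "complex_of_real \<rho> * (\<Sum>c<Suc L * ?K. Hmat F G m r c * cnj (Hmat F G m r' c))
      = ent (\<rho> *\<^sub>R (\<Sum>j<Suc L. H (r div ?N) j ** cadj (H (r' div ?N) j))) (r mod ?N) (r' mod ?N)"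
      by (simp only: scale)
    moreover have "(if r = r' then 1 else 0) = ent (if r div ?N = r' div ?N then mat 1 else 0 :: complex^'n^'n) (r mod ?N) (r' mod ?N)"
    proof -
      have "r = r' \<longleftrightarrow> r div ?N = r' div ?N \<and> r mod ?N = r' mod ?N"
        by (metis div_mult_mod_eq)
      then show ?thesis unfolding \<open>r = r' \<longleftrightarrow> _\<close> by (simp add: ent_def mat_def enum_ix_eq_iff)
    qed
    ultimately show ?thesis unfolding gram[OF lt] by (simp add: ent_def del: sum.lessThan_Suc)
  qed
  show ?thesis
    unfolding bdet_def det_nat_eq_det_mat
    by (intro arg_cong[of _ _ Determinant.det] cong_mat refl) (simp only: prod.case entry)
qed

lemma logdet_H_eq_sum:
  fixes F G :: "int \<Rightarrow> complex^'k^'n"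
  assumes "0 \<le> \<rho>" "m \<le> n"
  shows "logdet_H \<rho> F G m n = (\<Sum>j<nat (n - m + 1).
    ldetF \<rho> (F (m + int j)) (Xseq \<rho> (\<lambda>i. F (m + i)) (\<lambda>i. G (m + i)) (mat 1) j)
    - ldet (Xseq \<rho> (\<lambda>i. F (m + i)) (\<lambda>i. G (m + i)) (mat 1) (Suc j)))"
proof -
  \<comment> \<open>There is one block column more than block rows; m \<le> n keeps
    \<open>nat\<close> from truncating.\<close>
  have "nat (n - m + 2) = Suc (nat (n - m + 1))" using assms by simp
  then show ?thesis
    unfolding logdet_H_def Let_def det_nat_Hmat
    using bdet_gram_block[OF hpsd_one assms(1), of "nat (n - m + 1)" "\<lambda>i. F (m + i)" "\<lambda>i. G (m + i)"]
    by (simp add: det_nat_Hmat del: Xseq.simps mult_Suc)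
qed

section \<open>Orbits of the recursion\<close>

lemma matrix_inv_cramer:
  fixes A :: "complex^'n^'n"
  assumes "det A \<noteq> 0"
  shows "matrix_inv A = (\<chi> k j. det (\<chi> i l. if l = k then mat 1 $ i $ j else A $ i $ l) / det A)"
proof -
  have A: "A ** matrix_inv A = mat 1"
    using assms unfolding invertible_det_nz[symmetric] invertible_def matrix_inv_def
    by (rule someI_ex[THEN conjunct1])
  have "A *v column j (matrix_inv A) = column j (mat 1)" for j
    using arg_cong[OF A, of "\<lambda>M. column j M"]
    by (simp add: matrix_vector_mult_def matrix_matrix_mult_def column_def)
  then have "column j (matrix_inv A) = (\<chi> k. det (\<chi> i l. if l = k then column j (mat 1) $ i else A $ i $ l) / det A)" for j
    by (simp add: cramer[OF assms])
  then show ?thesis by (simp add: vec_eq_iff column_def cong: if_cong)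
qed

text \<open>Without an inverse the predicate inside \<open>SOME\<close> is constantly false, so all
  singular matrices share one value. This makes \<open>matrix_inv\<close> measurable everywhere and
  not only on the open set of invertible matrices.\<close>

lemma matrix_inv_singular:
  fixes A :: "complex^'n^'n"
  assumes "det A = 0"
  shows "matrix_inv A = matrix_inv 0"
proof -
  have "(\<lambda>B. B' ** B = mat 1 \<and> B ** B' = mat 1) = (\<lambda>_. False)" if "det B' = 0" for B' :: "complex^'n^'n"
    using that by (metis invertible_def invertible_det_nz)
  from this[of A] this[of 0] assms show ?thesis
    by (simp add: matrix_inv_def flip: mat_0)
qed

lemma continuous_on_det: "continuous_on S (\<lambda>x. f x) \<Longrightarrow> continuous_on S (\<lambda>x. det (f x :: complex^'n^'n))"
  unfolding Determinants.det_def by (intro continuous_intros)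

lemma continuous_on_matrix_inv:
  "continuous_on {A. det A \<noteq> 0} (matrix_inv :: complex^'n^'n \<Rightarrow> _)"
proof -
  have e: "continuous_on S (\<lambda>A :: complex^'n^'n. if l = k then c else A $ i $ l)" for S l k c i
    by (cases "l = k") (auto intro!: continuous_intros)
  have "continuous_on {A. det A \<noteq> 0} (\<lambda>A :: complex^'n^'n. \<chi> k j. det (\<chi> i l. if l = k then mat 1 $ i $ j else A $ i $ l) / det A)"
    by (intro continuous_on_vec_lambda continuous_on_divide continuous_on_det e continuous_on_id) auto
  then show ?thesis
    by (rule continuous_on_eq) (simp add: matrix_inv_cramer)
qed

lemma open_det_nz: "open {A :: complex^'n^'n. det A \<noteq> 0}"
  by (intro open_Collect_neq continuous_on_det continuous_on_id continuous_on_const)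

lemma bounded_bilinear_mat_mult: "bounded_bilinear (\<lambda>(A :: complex^'b^'a) (B :: complex^'c^'b). A ** B)"
proof (rule bilinear_conv_bounded_bilinear[THEN iffD1])
  show "bilinear (\<lambda>(A :: complex^'b^'a) (B :: complex^'c^'b). A ** B)"
    unfolding bilinear_def
    by (auto intro!: linearI simp: matrix_add_ldistrib mat_mult_add_left scaleR_mult_mat mult_scaleR_mat)
qed

lemmas tendsto_mat_mult = bounded_bilinear.tendsto[OF bounded_bilinear_mat_mult]

lemma tendsto_matrix_inv:
  fixes f :: "'b \<Rightarrow> complex^'n^'n"
  assumes "(f \<longlongrightarrow> A) F" "hpd A"
  shows "((\<lambda>x. matrix_inv (f x)) \<longlongrightarrow> matrix_inv A) F"
proof -
  have "det A \<noteq> 0" using det_hpd[OF assms(2)] by auto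
  then have "isCont matrix_inv A"
    using continuous_on_eq_continuous_at[OF open_det_nz] continuous_on_matrix_inv by blast
  then show ?thesis by (rule isCont_tendsto_compose[OF _ assms(1)])
qed

lemma tendsto_Wmap:
  assumes X: "(X \<longlongrightarrow> Y) F'" and Y: "hpsd Y" and \<rho>: "0 \<le> \<rho>"
  shows "((\<lambda>x. Wmap \<rho> F G (X x)) \<longlongrightarrow> Wmap \<rho> F G Y) F'"
  unfolding Wmap_def
  by (intro tendsto_matrix_inv tendsto_intros tendsto_mat_mult X hpd_outer_mat hpd_inner_mat Y \<rho>)

lemma tendsto_quadratic_form:
  assumes "(X \<longlongrightarrow> (Y :: complex^'n^'n)) F'"
  shows "((\<lambda>i. x \<bullet> (X i *v x)) \<longlongrightarrow> x \<bullet> (Y *v x)) F'"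
    unfolding matrix_vector_mult_def by (intro tendsto_intros tendsto_vec_lambda) (simp_all add: assms)

lemma loewner_le_limit:
  assumes "F' \<noteq> bot" "(X \<longlongrightarrow> X') F'" "(Y \<longlongrightarrow> Y') F'" "eventually (\<lambda>i. X i \<preceq> Y i) F'"
  shows "X' \<preceq> Y'"
  unfolding loewner_le_def
proof
  fix x
  show "x \<bullet> (X' *v x) \<le> x \<bullet> (Y' *v x)"
    using assms(4) by (intro tendsto_le[OF assms(1) tendsto_quadratic_form[OF assms(3)] tendsto_quadratic_form[OF assms(2)]])
      (auto elim: eventually_mono simp: loewner_le_def)
qed

lemma hpsd_limit:
  assumes "F' \<noteq> bot" "(X \<longlongrightarrow> X') F'" "eventually (\<lambda>i. hpsd (X i)) F'"
  shows "hpsd X'"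
proof -
  have "((\<lambda>i. cadj (X i)) \<longlongrightarrow> cadj X') F'"
    unfolding cadj_def by (intro tendsto_vec_lambda tendsto_cnj tendsto_vec_nth assms)
  moreover have "eventually (\<lambda>i. cadj (X i) = X i) F'"
    using assms(3) by eventually_elim (simp add: hpsd_def)
  ultimately have "(X \<longlongrightarrow> cadj X') F'" by (rule Lim_transform_eventually)
  then have "cadj X' = X'" using tendsto_unique[OF assms(1)] assms(2) by blast
  moreover have "0 \<preceq> X'"
    using assms(3) by (intro loewner_le_limit[OF assms(1) tendsto_const assms(2)])
      (auto elim: eventually_mono simp: hpsd_iff_loewner)
  ultimately show ?thesis by (simp add: hpsd_iff_loewner)
qed

lemma norm_mat_le:
  fixes A :: "complex^'b^'a" and b :: real
  assumes "\<And>i j. norm (A $ i $ j) \<le> b"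
  shows "norm A \<le> CARD('a) * (CARD('b) * b)"
proof -
  have "norm (A $ i) \<le> CARD('b) * b" for i
    unfolding norm_vec_def[of "A $ i"]
    using L2_set_le_sum[of UNIV "\<lambda>j. norm (A $ i $ j)"] sum_bounded_above[of UNIV "\<lambda>j. norm (A $ i $ j)" b] assms
    by (auto intro: order_trans)
  then show ?thesis
    unfolding norm_vec_def[of A]
    using L2_set_le_sum[of UNIV "\<lambda>i. norm (A $ i)"] sum_bounded_above[of UNIV "\<lambda>i. norm (A $ i)" "CARD('b) * b"]
    by (auto intro: order_trans)
qed

section \<open>Orbits indexed by their end time, and the limit from the remote past\<close>

type_synonym ('k, 'n) chan = "(complex^'k^'n) \<times> (complex^'k^'n)"

text \<open>State at time n of the orbit that was at X at time n - m. Fixing the end time lets m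
  grow into the past.\<close>

primrec iter :: "real \<Rightarrow> (int \<Rightarrow> ('k::finite, 'n::finite) chan) \<Rightarrow> complex^'k^'k \<Rightarrow> nat \<Rightarrow> int \<Rightarrow> complex^'k^'k" where
  "iter \<rho> e X 0 n = X"
| "iter \<rho> e X (Suc m) n = Wmap \<rho> (fst (e n)) (snd (e n)) (iter \<rho> e X m (n - 1))"

text \<open>Product of the factors q over the times n - m + 1, ..., n; the order factor t after m
  steps is 1 minus this product. The initial value 1 encodes t = 0.\<close>

primrec gap :: "real \<Rightarrow> (int \<Rightarrow> ('k::finite, 'n::finite) chan) \<Rightarrow> nat \<Rightarrow> int \<Rightarrow> real" where
  "gap \<rho> e 0 n = 1"
| "gap \<rho> e (Suc m) n = contr \<rho> (fst (e n)) * gap \<rho> e m (n - 1)"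

definition cost :: "real \<Rightarrow> ('k::finite, 'n::finite) chan \<Rightarrow> complex^'k^'k \<Rightarrow> real" where
  "cost \<rho> c W = ldetF \<rho> (fst c) W - ldet (Wmap \<rho> (fst c) (snd c) W)"

text \<open>Term j of \<open>Xseq\<close> has used the channel at the times a, ..., a + j - 1, hence
  the end time a + j - 1.\<close>

lemma Xseq_eq_iter:
  "Xseq \<rho> (\<lambda>i. fst (e (a + i))) (\<lambda>i. snd (e (a + i))) X j = iter \<rho> e X j (a + int j - 1)"
  by (induction j) (simp_all add: algebra_simps)

lemma iter_add: "iter \<rho> e X (m + p) n = iter \<rho> e (iter \<rho> e X p (n - int m)) m n"
  by (induction m arbitrary: n) (simp_all add: algebra_simps)

lemma gap_add: "gap \<rho> e (m + p) n = gap \<rho> e m n * gap \<rho> e p (n - int m)"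
  by (induction m arbitrary: n) (simp_all add: algebra_simps)

lemma iter_shift: "iter \<rho> (\<lambda>i. e (i + k)) X m n = iter \<rho> e X m (n + k)"
  by (induction m arbitrary: n) (simp_all add: algebra_simps)

lemma gap_shift: "gap \<rho> (\<lambda>i. e (i + k)) m n = gap \<rho> e m (n + k)"
  by (induction m arbitrary: n) (simp_all add: algebra_simps)

definition unit_interval :: "(complex^'k^'k) set" where
  "unit_interval = {X. hpsd X \<and> X \<preceq> mat 1}"

lemma unit_interval_one [simp]: "mat 1 \<in> unit_interval"
  by (simp add: unit_interval_def)

lemma tendsto_Cauchy_bound:
  fixes X :: "nat \<Rightarrow> 'a::banach"
  assumes "\<And>m p. norm (X (m + p) - X m) \<le> b m" "b \<longlonglongrightarrow> 0"
  shows "convergent X"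
proof (rule Cauchy_convergent, rule metric_CauchyI)
  fix \<epsilon> :: real assume "0 < \<epsilon>"
  then have "\<forall>\<^sub>F m in sequentially. b m < \<epsilon> / 2" using assms(2) by (intro order_tendstoD) auto
  then obtain M where M: "b M < \<epsilon> / 2" by (auto simp: eventually_sequentially)
  have "dist (X m) (X M) < \<epsilon> / 2" if "M \<le> m" for m
    using assms(1)[of M "m - M"] M that by (simp add: dist_norm)
  then show "\<exists>M. \<forall>m\<ge>M. \<forall>n\<ge>M. dist (X m) (X n) < \<epsilon>"
    by (metis dist_triangle_half_l)
qed

definition Wlim :: "real \<Rightarrow> (int \<Rightarrow> ('k::finite, 'n::finite) chan) \<Rightarrow> int \<Rightarrow> complex^'k^'k" where
  "Wlim \<rho> e n = lim (\<lambda>m. iter \<rho> e (mat 1) m n)"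

text \<open>Valid on every path, convergent or not, because \<open>lim\<close> is applied to
  identical sequences. Equivariance thus has no exceptional null set.\<close>

lemma Wlim_shift: "Wlim \<rho> (\<lambda>i. e (i + k)) n = Wlim \<rho> e (n + k)"
  by (simp add: Wlim_def iter_shift)

context
  fixes \<rho> :: real
  assumes rho: "0 \<le> \<rho>"
begin

lemma gap_bounds: "0 \<le> gap \<rho> e m n" "gap \<rho> e m n \<le> 1"
proof -
  have "0 \<le> gap \<rho> e m n \<and> gap \<rho> e m n \<le> 1"
    by (induction m arbitrary: n)
      (auto simp: contr_bounds[OF rho] less_imp_le intro!: mult_le_one)
  then show "0 \<le> gap \<rho> e m n" "gap \<rho> e m n \<le> 1" by auto
qed

lemma Wmap_unit_interval: "hpsd X \<Longrightarrow> Wmap \<rho> F G X \<in> unit_interval"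
  by (simp add: unit_interval_def hpd_imp_hpsd hpd_Wmap Wmap_le_one rho)

lemma iter_unit_interval: "X \<in> unit_interval \<Longrightarrow> iter \<rho> e X m n \<in> unit_interval"
proof (induction m arbitrary: n)
  case (Suc m)
  then show ?case using Wmap_unit_interval by (auto simp: unit_interval_def)
qed simp

text \<open>For m = 0 the claim is 0 \<preceq> Y; every step multiplies 1 - t by the factor of the
  current channel.\<close>

lemma iter_gap:
  assumes X: "X \<in> unit_interval" and Y: "Y \<in> unit_interval"
  shows "(1 - gap \<rho> e m n) *\<^sub>R iter \<rho> e X m n \<preceq> iter \<rho> e Y m n"
proof (induction m arbitrary: n)
  case 0
  then show ?case using Y by (simp add: unit_interval_def hpsd_iff_loewner)
next
  case (Suc m)
  have "(1 - (1 - (1 - gap \<rho> e m (n - 1))) * contr \<rho> (fst (e n))) *\<^sub>R iter \<rho> e X (Suc m) n \<preceq> iter \<rho> e Y (Suc m) n"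
    unfolding iter.simps
    using iter_unit_interval[OF X, of e m "n - 1"] iter_unit_interval[OF Y, of e m "n - 1"] gap_bounds[of e m "n - 1"]
    by (intro Wmap_contraction Suc.IH rho) (auto simp: unit_interval_def)
  then show ?case by (simp add: mult.commute)
qed

lemma iter_one_mono:
  assumes Y: "Y \<in> unit_interval"
  shows "iter \<rho> e Y m n \<preceq> iter \<rho> e (mat 1) m n"
proof (induction m arbitrary: n)
  case 0
  then show ?case using Y by (simp add: unit_interval_def)
next
  case (Suc m)
  then show ?case
    using iter_unit_interval[OF Y, of e m "n - 1"] iter_unit_interval[OF unit_interval_one, of e m "n - 1"]
    by (auto simp: unit_interval_def intro!: Wmap_mono rho)
qed

text \<open>The identity is the top of the order interval, so its orbit lies above every other one
  and the one-sided contraction bounds the difference on both sides. The 2 comes from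
  \<open>loewner_entry_bound\<close>, the cardinalities from \<open>norm_mat_le\<close>.\<close>

lemma iter_one_diff:
  fixes Y :: "complex^'k^'k"
  assumes Y: "Y \<in> unit_interval"
  shows "norm (iter \<rho> e Y m n - iter \<rho> e (mat 1) m n) \<le> CARD('k) * (CARD('k) * (2 * gap \<rho> e m n))"
proof -
  let ?I = "iter \<rho> e (mat 1) m n" and ?J = "iter \<rho> e Y m n" and ?g = "gap \<rho> e m n"
  have I: "?I \<in> unit_interval" and J: "?J \<in> unit_interval"
    using iter_unit_interval[OF Y] iter_unit_interval[OF unit_interval_one] by auto
  have "?I - ?J \<preceq> ?g *\<^sub>R ?I"
    using iter_gap[OF unit_interval_one Y, of e m n]
    by (simp add: loewner_le_def matrix_vector_mult_diff_rdistrib scaleR_mult_vec inner_diff_right algebra_simps)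
  moreover have "?g *\<^sub>R ?I \<preceq> ?g *\<^sub>R mat 1"
    using I gap_bounds by (intro loewner_scaleR_mono) (auto simp: unit_interval_def)
  ultimately have 1: "?I - ?J \<preceq> ?g *\<^sub>R mat 1" by (rule loewner_trans)
  have 2: "0 \<preceq> ?I - ?J"
    using iter_one_mono[OF Y, of e m n] by (simp add: loewner_le_def matrix_vector_mult_diff_rdistrib inner_diff_right)
  have "cadj (?I - ?J) = ?I - ?J"
    using I J by (simp add: cadj_diff unit_interval_def hpsd_def)
  from norm_mat_le[OF loewner_entry_bound[OF this 2 1]] show ?thesis
    by (simp add: norm_minus_commute)
qed

lemma cost_bounds:
  fixes c :: "('k::finite, 'n::finite) chan"
  assumes "W \<in> unit_interval"
  shows "0 \<le> cost \<rho> c W"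
    "cost \<rho> c W \<le> CARD('n) * (\<rho> * (norm (fst c))\<^sup>2) + CARD('k) * (\<rho> * (norm (snd c))\<^sup>2)"
  using ldetF_bounds[of W \<rho> "fst c"] ldet_Wmap_bounds(1)[of W \<rho> "fst c" "snd c"] ldet_Wmap_bounds(2)[of W \<rho> "snd c" "fst c"] assms rho
  by (auto simp: cost_def unit_interval_def)

text \<open>The comparison at factor t passes to \<open>inner_mat\<close> and to
  \<open>Wmap\<close>, where \<open>ldet_ge\<close> costs N or K times - ln t. The bound is the same
  for every channel value c.\<close>

lemma cost_diff:
  fixes c :: "('k::finite, 'n::finite) chan"
  assumes X: "X \<in> unit_interval" and Y: "Y \<in> unit_interval" and t: "0 < t" "t \<le> 1"
    and le: "t *\<^sub>R X \<preceq> Y" "t *\<^sub>R Y \<preceq> X"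
  shows "\<bar>cost \<rho> c X - cost \<rho> c Y\<bar> \<le> (CARD('n) + CARD('k)) * (- ln t)"
proof -
  have one: "CARD('n) * ln t + ldetF \<rho> (fst c) X \<le> ldetF \<rho> (fst c) Y \<and>
    CARD('k) * ln t + ldet (Wmap \<rho> (fst c) (snd c) X) \<le> ldet (Wmap \<rho> (fst c) (snd c) Y)"
    if X: "hpsd X" "X \<preceq> mat 1" and Y: "hpsd Y" "Y \<preceq> mat 1" and le: "t *\<^sub>R X \<preceq> Y" for X Y :: "complex^'k^'k"
  proof -
    let ?s = "1 - (1 - t) * contr \<rho> (fst c)"
    \<comment> \<open>The map improves the factor to \<open>?s\<close>; this is relaxed to t again,
      so that both determinants are compared at the same factor.\<close>
    have "(1 - t) * contr \<rho> (fst c) \<le> (1 - t) * 1"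
      using t contr_bounds[OF rho, of "fst c"] by (intro mult_left_mono) auto
    then have s: "t \<le> ?s" by simp
    have A: "t *\<^sub>R inner_mat \<rho> (fst c) X \<preceq> inner_mat \<rho> (fst c) Y"
      using inner_mat_contraction[OF X(2) le t(2) rho, of "fst c"]
        loewner_scaleR_left_mono[OF hpd_imp_hpsd[OF hpd_inner_mat[OF X(1) rho]] s, of "fst c"]
      by (rule loewner_trans[rotated])
    have B: "t *\<^sub>R Wmap \<rho> (fst c) (snd c) X \<preceq> Wmap \<rho> (fst c) (snd c) Y"
      using Wmap_contraction[OF X Y(1) le less_imp_le[OF t(1)] t(2) rho, of "fst c" "snd c"]
        loewner_scaleR_left_mono[OF hpd_imp_hpsd[OF hpd_Wmap[OF X(1) rho]] s, of "fst c" "snd c"]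
      by (rule loewner_trans[rotated])
    show ?thesis
      using ldet_ge[OF hpd_inner_mat[OF X(1) rho] hpd_inner_mat[OF Y(1) rho] t(1) A]
        ldet_ge[OF hpd_Wmap[OF X(1) rho] hpd_Wmap[OF Y(1) rho] t(1) B] by (simp add: ldetF_def)
  qed
  show ?thesis
    using one[of X Y] one[of Y X] X Y le by (auto simp: unit_interval_def cost_def abs_le_iff algebra_simps)
qed

lemma cost_iter_diff:
  fixes e :: "int \<Rightarrow> ('k::finite, 'n::finite) chan" and c :: "('k, 'n) chan"
  assumes "X \<in> unit_interval" "Y \<in> unit_interval" "gap \<rho> e m n < 1"
  shows "\<bar>cost \<rho> c (iter \<rho> e X m n) - cost \<rho> c (iter \<rho> e Y m n)\<bar> \<le> (CARD('n) + CARD('k)) * (- ln (1 - gap \<rho> e m n))"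
  using assms gap_bounds[of e m n] by (intro cost_diff iter_unit_interval iter_gap) auto

context
  fixes e :: "int \<Rightarrow> ('k::finite, 'n::finite) chan"
  assumes gap: "\<And>n. (\<lambda>m. gap \<rho> e m n) \<longlonglongrightarrow> 0"
begin

lemma iter_tendsto_Wlim: "(\<lambda>m. iter \<rho> e (mat 1) m n) \<longlonglongrightarrow> Wlim \<rho> e n"
proof -
  have "convergent (\<lambda>m. iter \<rho> e (mat 1) m n)"
  proof (rule tendsto_Cauchy_bound)
    \<comment> \<open>An orbit reaching p steps further back is an m-step orbit started at another
      matrix of the order interval.\<close>
    show "norm (iter \<rho> e (mat 1) (m + p) n - iter \<rho> e (mat 1) m n) \<le> CARD('k) * (CARD('k) * (2 * gap \<rho> e m n))" for m p
      unfolding iter_add by (intro iter_one_diff iter_unit_interval) simp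
    show "(\<lambda>m. CARD('k) * (CARD('k) * (2 * gap \<rho> e m n))) \<longlonglongrightarrow> 0"
      by (intro tendsto_mult_right_zero gap)
  qed
  then show ?thesis unfolding Wlim_def by (simp add: convergent_LIMSEQ_iff)
qed

lemma Wlim_unit_interval: "Wlim \<rho> e n \<in> unit_interval"
proof -
  have i: "hpsd (iter \<rho> e (mat 1) m n)" "iter \<rho> e (mat 1) m n \<preceq> mat 1" for m
    using iter_unit_interval[OF unit_interval_one, of e m n] by (auto simp: unit_interval_def)
  show ?thesis
    unfolding unit_interval_def
    using hpsd_limit[OF _ iter_tendsto_Wlim[of n]] loewner_le_limit[OF _ iter_tendsto_Wlim[of n] tendsto_const] i
    by auto
qed

lemma Wlim_rec: "Wlim \<rho> e n = Wmap \<rho> (fst (e n)) (snd (e n)) (Wlim \<rho> e (n - 1))"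
proof -
  have "(\<lambda>m. iter \<rho> e (mat 1) (Suc m) n) \<longlonglongrightarrow> Wmap \<rho> (fst (e n)) (snd (e n)) (Wlim \<rho> e (n - 1))"
    using Wlim_unit_interval[of "n - 1"] unfolding iter.simps
    by (intro tendsto_Wmap iter_tendsto_Wlim rho) (simp add: unit_interval_def)
  moreover have "(\<lambda>m. iter \<rho> e (mat 1) (Suc m) n) \<longlonglongrightarrow> Wlim \<rho> e n"
    by (rule LIMSEQ_Suc[OF iter_tendsto_Wlim])
  ultimately show ?thesis using LIMSEQ_unique by blast
qed

text \<open>Passing to the limit preserves only semidefiniteness; definiteness comes back from the
  equation, since \<open>Wmap\<close> sends semidefinite matrices to definite ones.\<close>

lemma hpd_Wlim: "hpd (Wlim \<rho> e n)"
  using Wlim_unit_interval[of "n - 1"] by (subst Wlim_rec) (simp add: hpd_Wmap unit_interval_def rho)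

lemma Wlim_eq_iter: "Wlim \<rho> e n = iter \<rho> e (Wlim \<rho> e (n - int m)) m n"
proof (induction m arbitrary: n)
  case (Suc m)
  show ?case by (subst Wlim_rec, subst Suc) (simp add: algebra_simps)
qed simp

text \<open>A solution lies in the order interval, being an image of \<open>Wmap\<close>, and at
  each depth m it is an orbit started from its own value at n - m. That start moves with m, but
  \<open>iter_one_diff\<close> is uniform in it.\<close>

lemma Wlim_unique:
  assumes W: "\<And>n. hpsd (W n)" "\<And>n. W n = Wmap \<rho> (fst (e n)) (snd (e n)) (W (n - 1))"
  shows "W n = Wlim \<rho> e n"
proof -
  have u: "W n \<in> unit_interval" for n
    using Wmap_unit_interval[OF W(1)[of "n - 1"]] W(2)[of n] by metis
  have it: "W n = iter \<rho> e (W (n - int m)) m n" for m n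
  proof (induction m arbitrary: n)
    case (Suc m)
    show ?case by (subst W(2), subst Suc) (simp add: algebra_simps)
  qed simp
  have "(\<lambda>m. iter \<rho> e (mat 1) m n) \<longlonglongrightarrow> W n"
  proof (rule LIM_zero_cancel, rule Lim_null_comparison)
    show "\<forall>\<^sub>F m in sequentially. norm (iter \<rho> e (mat 1) m n - W n) \<le> CARD('k) * (CARD('k) * (2 * gap \<rho> e m n))"
    proof (intro always_eventually allI)
      fix m
      show "norm (iter \<rho> e (mat 1) m n - W n) \<le> CARD('k) * (CARD('k) * (2 * gap \<rho> e m n))"
        using iter_one_diff[OF u[of "n - int m"], where e=e and m=m and n=n] unfolding it[of n m, symmetric]
        by (simp add: norm_minus_commute)
    qed
    show "(\<lambda>m. CARD('k) * (CARD('k) * (2 * gap \<rho> e m n))) \<longlonglongrightarrow> 0"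
      by (intro tendsto_mult_right_zero gap)
  qed
  then show ?thesis using iter_tendsto_Wlim LIMSEQ_unique by blast
qed

lemma cost_iter_tendsto:
  fixes c :: "('k, 'n) chan"
  shows "(\<lambda>m. cost \<rho> c (iter \<rho> e (mat 1) m n)) \<longlonglongrightarrow> cost \<rho> c (Wlim \<rho> e n)"
proof (rule LIM_zero_cancel, rule Lim_null_comparison)
  have "\<forall>\<^sub>F m in sequentially. gap \<rho> e m n < 1"
    using gap[of n] by (rule order_tendstoD) simp
  then show "\<forall>\<^sub>F m in sequentially. norm (cost \<rho> c (iter \<rho> e (mat 1) m n) - cost \<rho> c (Wlim \<rho> e n))
      \<le> (CARD('n) + CARD('k)) * (- ln (1 - gap \<rho> e m n))"
  proof eventually_elim
    case (elim m)
    show ?case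
      using cost_iter_diff[OF unit_interval_one Wlim_unit_interval elim, of c] by (subst Wlim_eq_iter[of n m]) simp
  qed
  have "(\<lambda>m. (CARD('n) + CARD('k)) * (- ln (1 - gap \<rho> e m n))) \<longlonglongrightarrow> (CARD('n) + CARD('k)) * (- ln (1 - 0))"
    by (intro tendsto_intros gap) auto
  then show "(\<lambda>m. (CARD('n) + CARD('k)) * (- ln (1 - gap \<rho> e m n))) \<longlonglongrightarrow> 0" by simp
qed

end

end

section \<open>Birkhoff's ergodic theorem\<close>

locale ergodic_system = prob_space M for M :: "'a measure" +
  fixes T :: "'a \<Rightarrow> 'a"
  assumes T_meas [measurable]: "T \<in> M \<rightarrow>\<^sub>M M"
    and T_distr: "distr M M T = M"
    and T_ergodic: "\<And>A. A \<in> sets M \<Longrightarrow> T -` A \<inter> space M = A \<Longrightarrow> prob A = 0 \<or> prob A = 1"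
begin

lemma integrable_comp:
  assumes "integrable M (f :: 'a \<Rightarrow> real)" shows "integrable M (\<lambda>x. f (T x))"
  using integrable_distr[OF T_meas, of f] assms by (simp add: T_distr)

lemma integral_comp:
  assumes [measurable]: "f \<in> borel_measurable M" shows "(\<integral>x. f (T x) \<partial>M) = (\<integral>x. (f x :: real) \<partial>M)"
  using integral_distr[OF T_meas, of f] by (simp add: T_distr)

definition ergodic_sum :: "('a \<Rightarrow> real) \<Rightarrow> nat \<Rightarrow> 'a \<Rightarrow> real" where
  "ergodic_sum f n x = (\<Sum>i<n. f ((T ^^ i) x))"

lemma ergodic_sum_Suc: "ergodic_sum f (Suc n) x = f x + ergodic_sum f n (T x)"
  unfolding ergodic_sum_def by (subst sum.lessThan_Suc_shift) (simp add: funpow_swap1)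

text \<open>The maximum of \<open>ergodic_sum f i x\<close> over i \<le> n, in a recursive form that
  exhibits its increment along \<open>T\<close>.\<close>

primrec max_sum :: "('a \<Rightarrow> real) \<Rightarrow> nat \<Rightarrow> 'a \<Rightarrow> real" where
  "max_sum f 0 x = 0"
| "max_sum f (Suc n) x = max 0 (f x + max_sum f n (T x))"

lemma max_sum_nonneg: "0 \<le> max_sum f n x"
  by (cases n) auto

lemma ergodic_sum_le_max_sum: "ergodic_sum f n x \<le> max_sum f n x"
proof (induction n arbitrary: x)
  case (Suc n)
  then show ?case by (simp add: ergodic_sum_Suc le_max_iff_disj add_mono)
qed (simp add: ergodic_sum_def)

lemma max_sum_mono_Suc: "max_sum f n x \<le> max_sum f (Suc n) x"
proof (induction n arbitrary: x)
  case (Suc n)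
  show ?case using Suc[of "T x"] by (auto simp: max_def)
qed simp

lemma integrable_max_sum: "integrable M f \<Longrightarrow> integrable M (max_sum f n)"
proof (induction n)
  case (Suc n)
  then have "integrable M (\<lambda>x. f x + max_sum f n (T x))"
    by (intro Bochner_Integration.integrable_add integrable_comp) auto
  then show ?case by simp
next
  case 0
  have "max_sum f 0 = (\<lambda>_. 0)" by auto
  then show ?case by simp
qed

text \<open>The set where the maximal sums are unbounded is invariant; on it the increments of the
  maximal sums along T decrease to f, so a negative mean forces it to be null.\<close>

lemma max_sum_bounded:
  assumes f: "integrable M f" and neg: "(\<integral>x. f x \<partial>M) < 0"
  shows "AE x in M. \<exists>C. \<forall>n. max_sum f n x \<le> C"
proof -
  define A where "A = {x \<in> space M. \<forall>k::nat. \<exists>n. real k \<le> max_sum f n x}"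
  have [measurable]: "f \<in> borel_measurable M" "\<And>n. max_sum f n \<in> borel_measurable M"
    using f integrable_max_sum[OF f] by auto
  have A[measurable]: "A \<in> sets M" unfolding A_def by measurable
  have mono: "max_sum f m x \<le> max_sum f n x" if "m \<le> n" for m n x
    by (rule lift_Suc_mono_le[of "\<lambda>n. max_sum f n x", OF max_sum_mono_Suc that])
  have inv: "T -` A \<inter> space M = A"
  proof (intro equalityI subsetI)
    fix x assume x: "x \<in> T -` A \<inter> space M"
    have "\<exists>n. real k \<le> max_sum f n x" for k
    proof -
      obtain j :: nat where j: "real k - f x \<le> real j" using real_arch_simple by blast
      obtain n where "real j \<le> max_sum f n (T x)" using x by (auto simp: A_def)
      then show ?thesis using j by (intro exI[of _ "Suc n"]) auto
    qed
    then show "x \<in> A" using x by (auto simp: A_def)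
  next
    fix x assume x: "x \<in> A"
    then have sp: "x \<in> space M" by (simp add: A_def)
    have "\<exists>n. real k \<le> max_sum f n (T x)" for k
    proof -
      \<comment> \<open>The margin excludes n = 0 and ensures that the second argument of the
        maximum in \<open>max_sum\<close> is the larger one.\<close>
      obtain j :: nat where j: "max 0 (real k + f x) + 1 \<le> real j" using real_arch_simple by blast
      obtain n where n: "real j \<le> max_sum f n x" using x by (auto simp: A_def)
      then obtain m where "n = Suc m" using j by (cases n) auto
      then show ?thesis using n j by (intro exI[of _ m]) (auto simp: max_def split: if_splits)
    qed
    then show "x \<in> T -` A \<inter> space M" using sp measurable_space[OF T_meas sp] by (auto simp: A_def)
  qed
  have "prob A \<noteq> 1"
  proof
    assume "prob A = 1"
    then have AE_A: "AE x in M. x \<in> A" by (simp add: prob_eq_1)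
    define d where "d n x = max_sum f (Suc n) x - max_sum f n (T x)" for n x
    have d_eq: "d n x = max (f x) (- max_sum f n (T x))" for n x
      by (auto simp: d_def max_def)
    \<comment> \<open>Invariance of the measure turns this mean into the increase of the mean of
      \<open>max_sum\<close> from n to n + 1.\<close>
    have d_int: "0 \<le> (\<integral>x. d n x \<partial>M)" for n
    proof -
      have "(\<integral>x. d n x \<partial>M) = (\<integral>x. max_sum f (Suc n) x \<partial>M) - (\<integral>x. max_sum f n (T x) \<partial>M)"
        unfolding d_def by (intro Bochner_Integration.integral_diff integrable_max_sum integrable_comp f)
      also have "\<dots> = (\<integral>x. max_sum f (Suc n) x \<partial>M) - (\<integral>x. max_sum f n x \<partial>M)"
        by (simp add: integral_comp del: max_sum.simps)
      also have "\<dots> \<ge> 0"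
        using integral_mono[OF integrable_max_sum[OF f] integrable_max_sum[OF f] max_sum_mono_Suc] by simp
      finally show ?thesis .
    qed
    have "(\<lambda>n. \<integral>x. d n x \<partial>M) \<longlonglongrightarrow> (\<integral>x. f x \<partial>M)"
    proof (rule integral_dominated_convergence[where w = "\<lambda>x. \<bar>f x\<bar>"])
      show "AE x in M. (\<lambda>n. d n x) \<longlonglongrightarrow> f x"
        using AE_A
      proof eventually_elim
        case (elim x)
        then have "T x \<in> A" using inv by auto
        obtain k :: nat where k: "- f x \<le> real k" using real_arch_simple by blast
        obtain n where n: "real k \<le> max_sum f n (T x)" using \<open>T x \<in> A\<close> by (auto simp: A_def)
        have "d m x = f x" if "n \<le> m" for m
          using mono[OF that, of "T x"] n k by (simp add: d_eq max_def)
        then show ?case by (intro tendsto_eventually) (auto simp: eventually_sequentially)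
      qed
      \<comment> \<open>Where the maximum differs from f, both are at most 0 and f is the smaller,
        so the absolute value stays below that of f.\<close>
      show "AE x in M. norm (d n x) \<le> \<bar>f x\<bar>" for n
        using max_sum_nonneg[of f n] by (intro AE_I2) (auto simp: d_eq max_def abs_if, (smt (verit))+)
    qed (use f in \<open>auto simp: d_def\<close>)
    then have "0 \<le> (\<integral>x. f x \<partial>M)"
      by (rule LIMSEQ_le_const) (use d_int in auto)
    then show False using neg by simp
  qed
  then have "prob A = 0" using T_ergodic[OF A inv] by simp
  then have "AE x in M. x \<notin> A" using A by (simp add: prob_eq_0)
  then show ?thesis
  proof (rule AE_mp, intro AE_I2 impI)
    fix x assume "x \<in> space M" "x \<notin> A"
    then obtain k :: nat where "\<forall>n. \<not> real k \<le> max_sum f n x" by (auto simp: A_def)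
    then show "\<exists>C. \<forall>n. max_sum f n x \<le> C" by (intro exI[of _ "real k"]) (auto simp: not_le less_imp_le)
  qed
qed

text \<open>With c slightly above the mean, f - c has negative mean and bounded maximal sums, so a
  sum of n terms is at most n c + C. One margin 1 / Suc k is spent on c and another on C / n; taking
  countably many k keeps a single null set.\<close>

lemma birkhoff_upper:
  assumes f: "integrable M f"
  shows "AE x in M. \<forall>k::nat. \<forall>\<^sub>F n in sequentially. ergodic_sum f n x / real n \<le> (\<integral>x. f x \<partial>M) + 2 / Suc k"
  unfolding AE_all_countable
proof
  fix k :: nat
  let ?c = "(\<integral>x. f x \<partial>M) + 1 / Suc k"
  let ?g = "\<lambda>x. f x - ?c"
  have g: "integrable M ?g" using f by auto
  have "(\<integral>x. ?g x \<partial>M) < 0" using f by (simp add: prob_space)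
  from max_sum_bounded[OF g this]
  show "AE x in M. \<forall>\<^sub>F n in sequentially. ergodic_sum f n x / real n \<le> (\<integral>x. f x \<partial>M) + 2 / Suc k"
  proof eventually_elim
    case (elim x)
    then obtain C where C: "\<And>n. max_sum ?g n x \<le> C" by blast
    have le: "ergodic_sum f n x / n \<le> ?c + C / n" if "0 < n" for n
    proof -
      have "ergodic_sum f n x - n * ?c \<le> C"
        using ergodic_sum_le_max_sum[of ?g n x] C[of n] by (simp add: ergodic_sum_def sum_subtractf)
      then have "ergodic_sum f n x / n \<le> (n * ?c + C) / n" by (intro divide_right_mono) auto
      also have "\<dots> = ?c + C / n" using that by (simp add: add_divide_distrib del: of_nat_Suc)
      finally show ?thesis .
    qed
    have "(\<lambda>n. C / real n) \<longlonglongrightarrow> 0" by (rule lim_const_over_n)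
    then have "\<forall>\<^sub>F n in sequentially. C / real n < 1 / Suc k" by (rule order_tendstoD) simp
    with eventually_gt_at_top[of 0] show ?case
    proof eventually_elim
      case (elim n)
      have "1 / real (Suc k) + 1 / real (Suc k) = 2 / real (Suc k)" by simp
      then show ?case using le[OF elim(1)] elim(2) by linarith
    qed
  qed
qed

theorem birkhoff:
  assumes f: "integrable M f"
  shows "AE x in M. (\<lambda>n. (\<Sum>i<n. f ((T ^^ i) x)) / real n) \<longlonglongrightarrow> (\<integral>x. f x \<partial>M)"
proof -
  have f': "integrable M (\<lambda>x. - f x)" using f by simp
  show ?thesis
    using birkhoff_upper[OF f] birkhoff_upper[OF f']
  proof eventually_elim
    case (elim x)
    let ?I = "\<integral>x. f x \<partial>M"
    have up: "\<forall>\<^sub>F n in sequentially. \<bar>ergodic_sum f n x / n - ?I\<bar> \<le> 2 / Suc k" for k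
      using spec[OF elim(1), of k] spec[OF elim(2), of k]
      by eventually_elim (auto simp: ergodic_sum_def sum_negf)
    have "(\<lambda>n. ergodic_sum f n x / n) \<longlonglongrightarrow> ?I"
    proof (rule tendstoI)
      fix e :: real assume "0 < e"
      then obtain k where "2 / e < Suc k" by (meson lessI less_trans of_nat_less_iff reals_Archimedean2)
      then have k: "2 / Suc k < e" using \<open>0 < e\<close> by (simp add: field_simps)
      show "\<forall>\<^sub>F n in sequentially. dist (ergodic_sum f n x / n) ?I < e"
        using up[of k] by eventually_elim (use k in \<open>auto simp: dist_real_def\<close>)
    qed
    then show ?case by (simp add: ergodic_sum_def)
  qed
qed

end

section \<open>Stationary channels\<close>

lemma cesaro_mean_LIMSEQ:
  fixes a :: "nat \<Rightarrow> real"
  assumes "a \<longlonglongrightarrow> L"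
  shows "(\<lambda>n. (\<Sum>i<n. a i) / real n) \<longlonglongrightarrow> L"
proof (rule LIM_zero_cancel, rule tendstoI)
  fix \<epsilon> :: real assume "0 < \<epsilon>"
  then obtain M where M: "\<And>i. M \<le> i \<Longrightarrow> \<bar>a i - L\<bar> < \<epsilon> / 2"
    using LIMSEQ_D[OF assms, of "\<epsilon> / 2"] by auto
  let ?C = "\<Sum>i<M. \<bar>a i - L\<bar>"
  have "(\<lambda>n. ?C / real n) \<longlonglongrightarrow> 0" by (rule lim_const_over_n)
  then have "\<forall>\<^sub>F n in sequentially. ?C / real n < \<epsilon> / 2"
    using \<open>0 < \<epsilon>\<close> by (intro order_tendstoD) auto
  with eventually_gt_at_top[of 0] eventually_ge_at_top[of M]
  show "\<forall>\<^sub>F n in sequentially. dist ((\<Sum>i<n. a i) / real n - L) 0 < \<epsilon>"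
  proof eventually_elim
    case (elim n)
    have "(\<Sum>i<n. a i) / real n - L = (\<Sum>i<n. a i - L) / real n"
      using elim by (simp add: sum_subtractf field_simps)
    moreover have "\<bar>\<Sum>i<n. a i - L\<bar> \<le> ?C + real n * (\<epsilon> / 2)"
    proof -
      have "\<bar>\<Sum>i<n. a i - L\<bar> \<le> (\<Sum>i<n. \<bar>a i - L\<bar>)" by (rule sum_abs)
      also have "\<dots> = ?C + (\<Sum>i=M..<n. \<bar>a i - L\<bar>)"
        using elim by (simp add: sum.atLeastLessThan_concat lessThan_atLeast0)
      also have "(\<Sum>i=M..<n. \<bar>a i - L\<bar>) \<le> (\<Sum>i=M..<n. \<epsilon> / 2)"
        using M by (intro sum_mono less_imp_le) auto
      also have "\<dots> \<le> real n * (\<epsilon> / 2)" using \<open>0 < \<epsilon>\<close> by simp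
      finally show ?thesis by simp
    qed
    then have "\<bar>\<Sum>i<n. a i - L\<bar> / real n \<le> (?C + real n * (\<epsilon> / 2)) / real n"
      by (intro divide_right_mono) auto
    ultimately have "dist ((\<Sum>i<n. a i) / real n - L) 0 \<le> ?C / real n + \<epsilon> / 2"
      using elim(1) by (simp add: add_divide_distrib dist_real_def)
    then show ?case using elim(3) by linarith
  qed
qed

section \<open>Borel measurability of the matrix operations\<close>

lemma borel_measurable_det [measurable (raw)]:
  "f \<in> borel_measurable M \<Longrightarrow> (\<lambda>x. det (f x :: complex^'n^'n)) \<in> borel_measurable M"
  by (rule borel_measurable_continuous_onI[OF continuous_on_det[OF continuous_on_id], THEN measurable_compose[rotated]])

lemma borel_measurable_ldet [measurable (raw)]:
  "f \<in> borel_measurable M \<Longrightarrow> (\<lambda>x. ldet (f x :: complex^'n^'n)) \<in> borel_measurable M"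
  unfolding ldet_def by measurable

lemma borel_measurable_mat_mult [measurable (raw)]:
  assumes "f \<in> borel_measurable M" "g \<in> borel_measurable M"
  shows "(\<lambda>x. (f x :: complex^'b^'a) ** (g x :: complex^'c^'b)) \<in> borel_measurable M"
  by (rule borel_measurable_continuous_Pair[OF assms])
    (rule bounded_bilinear.continuous_on[OF bounded_bilinear_mat_mult
        continuous_on_fst[OF continuous_on_id] continuous_on_snd[OF continuous_on_id]])

lemma borel_measurable_cadj [measurable (raw)]:
  assumes "f \<in> borel_measurable M"
  shows "(\<lambda>x. cadj (f x :: complex^'b^'a)) \<in> borel_measurable M"
proof -
  have "continuous_on UNIV (cadj :: complex^'b^'a \<Rightarrow> _)"
    unfolding cadj_def by (intro continuous_on_vec_lambda continuous_intros)
  then show ?thesis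
    by (rule borel_measurable_continuous_onI[THEN measurable_compose[OF assms]])
qed

lemma borel_measurable_matrix_inv [measurable (raw)]:
  assumes "f \<in> borel_measurable M"
  shows "(\<lambda>x. matrix_inv (f x :: complex^'n^'n)) \<in> borel_measurable M"
proof -
  have "(\<lambda>A :: complex^'n^'n. if A \<in> {A. det A \<noteq> 0} then matrix_inv A else matrix_inv 0) \<in> borel_measurable borel"
    using open_det_nz by (intro borel_measurable_continuous_on_if continuous_on_matrix_inv continuous_on_const) auto
  also have "(\<lambda>A :: complex^'n^'n. if A \<in> {A. det A \<noteq> 0} then matrix_inv A else matrix_inv 0) = matrix_inv"
    by (auto simp: fun_eq_iff intro: matrix_inv_singular[symmetric])
  finally show ?thesis by (rule measurable_compose[OF assms])
qed

lemma borel_measurable_Wmap [measurable (raw)]: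
  fixes f g :: "'x \<Rightarrow> complex^'k^'n"
  assumes [measurable]: "f \<in> borel_measurable M" "g \<in> borel_measurable M" "h \<in> borel_measurable M"
  shows "(\<lambda>x. Wmap \<rho> (f x) (g x) (h x)) \<in> borel_measurable M"
  unfolding Wmap_def by measurable

lemma borel_measurable_ldetF [measurable (raw)]:
  fixes f :: "'x \<Rightarrow> complex^'k^'n"
  assumes [measurable]: "f \<in> borel_measurable M" "h \<in> borel_measurable M"
  shows "(\<lambda>x. ldetF \<rho> (f x) (h x)) \<in> borel_measurable M"
  unfolding ldetF_def by measurable

lemma borel_measurable_fst [measurable (raw)]:
  "f \<in> borel_measurable M \<Longrightarrow> (\<lambda>x. fst (f x :: 'a::topological_space \<times> 'b::topological_space)) \<in> borel_measurable M"
  by (rule measurable_compose[OF _ borel_measurable_continuous_onI[OF continuous_on_fst[OF continuous_on_id]]])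

lemma borel_measurable_snd [measurable (raw)]:
  "f \<in> borel_measurable M \<Longrightarrow> (\<lambda>x. snd (f x :: 'a::topological_space \<times> 'b::topological_space)) \<in> borel_measurable M"
  by (rule measurable_compose[OF _ borel_measurable_continuous_onI[OF continuous_on_snd[OF continuous_on_id]]])

lemma borel_measurable_cost [measurable (raw)]:
  fixes f :: "'x \<Rightarrow> ('k::finite, 'n::finite) chan"
  assumes [measurable]: "f \<in> borel_measurable M" "h \<in> borel_measurable M"
  shows "(\<lambda>x. cost \<rho> (f x) (h x)) \<in> borel_measurable M"
  unfolding cost_def by measurable

lemma borel_measurable_contr [measurable (raw)]:
  fixes f :: "'x \<Rightarrow> complex^'k^'n"
  assumes [measurable]: "f \<in> borel_measurable M"
  shows "(\<lambda>x. contr \<rho> (f x)) \<in> borel_measurable M"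
  unfolding contr_def by measurable

section \<open>Path space, its shifts, and products of contraction factors\<close>

lemma path_component_measurable: "(\<lambda>e. e n) \<in> (path_space :: (int \<Rightarrow> 'e::topological_space) measure) \<rightarrow>\<^sub>M borel"
  by (rule measurable_component_singleton) simp

lemma space_path_space [simp]: "space (path_space :: (int \<Rightarrow> 'e::topological_space) measure) = UNIV"
  by (simp add: space_PiM)

lemma measurable_path:
  assumes "\<And>n. (\<lambda>x. f x n) \<in> borel_measurable M"
  shows "f \<in> M \<rightarrow>\<^sub>M (path_space :: (int \<Rightarrow> 'e::topological_space) measure)"
  using measurable_PiM_single'[of UNIV "\<lambda>n x. f x n" M "\<lambda>_. borel"] assms by simp

definition int_shift :: "int \<Rightarrow> (int \<Rightarrow> 'e) \<Rightarrow> int \<Rightarrow> 'e" where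
  "int_shift k e = (\<lambda>i. e (i + k))"

lemma shift_eq_int_shift: "shift = int_shift 1"
  by (simp add: fun_eq_iff shift_def int_shift_def)

lemma measurable_int_shift: "int_shift k \<in> (path_space :: (int \<Rightarrow> 'e::topological_space) measure) \<rightarrow>\<^sub>M path_space"
  unfolding int_shift_def by (intro measurable_path path_component_measurable)

lemma int_shift_add: "int_shift k \<circ> int_shift l = int_shift (k + l)"
  by (simp add: fun_eq_iff int_shift_def algebra_simps)

lemma int_shift_0: "int_shift 0 = id"
  by (simp add: fun_eq_iff int_shift_def)

lemma funpow_shift: "(shift ^^ n) e = (\<lambda>i. e (i + int n))"
  by (induction n arbitrary: e) (simp_all add: shift_def fun_eq_iff funpow_swap1 algebra_simps)

text \<open>The argument is carried out for the law of the channel on path space. There the shift is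
  a measure preserving map, and the solution is a function of the path.\<close>

locale stationary_channel = prob_space \<mu>
  for \<mu> :: "(int \<Rightarrow> ('k::finite, 'n::finite) chan) measure" +
  fixes \<rho> :: real
  assumes sets_mu: "sets \<mu> = sets path_space"
    and shift_inv: "distr \<mu> path_space shift = \<mu>"
    and rho: "0 \<le> \<rho>"
begin

lemma space_mu [simp]: "space \<mu> = UNIV"
  using sets_eq_imp_space_eq[OF sets_mu] by simp

lemma measurable_mu: "measurable \<mu> N = measurable path_space N"
  by (rule measurable_cong_sets[OF sets_mu refl])

lemma component_measurable [measurable]: "(\<lambda>e. e n) \<in> borel_measurable \<mu>"
  unfolding measurable_mu by (rule path_component_measurable)

text \<open>Negative k matter because the solution looks into the past; they follow by pushing the
  law forward with the inverse shift.\<close>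

lemma int_shift_inv: "distr \<mu> path_space (int_shift k) = \<mu>"
proof -
  have nat: "distr \<mu> path_space (int_shift (int n)) = \<mu>" for n
  proof (induction n)
    case 0
    show ?case by (simp add: int_shift_0 id_def distr_id2[OF sets_mu[symmetric]])
  next
    case (Suc n)
    have "distr \<mu> path_space (int_shift (int (Suc n))) = distr (distr \<mu> path_space (int_shift (int n))) path_space shift"
      unfolding shift_eq_int_shift
      by (subst distr_distr) (auto simp: measurable_mu measurable_int_shift int_shift_add)
    then show ?case using Suc shift_inv by simp
  qed
  show ?thesis
  proof (cases "0 \<le> k")
    case True
    then show ?thesis using nat[of "nat k"] by simp
  next
    case False
    have "distr (distr \<mu> path_space (int_shift (int (nat (- k))))) path_space (int_shift k) = distr \<mu> path_space id"
      using False by (subst distr_distr) (auto simp: measurable_mu measurable_int_shift int_shift_add int_shift_0)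
    then show ?thesis unfolding nat by (simp add: id_def distr_id2[OF sets_mu[symmetric]])
  qed
qed

lemma integral_int_shift:
  fixes f :: "_ \<Rightarrow> real"
  assumes "f \<in> borel_measurable \<mu>"
  shows "(\<integral>e. f (int_shift k e) \<partial>\<mu>) = (\<integral>e. f e \<partial>\<mu>)"
  using integral_distr[of "int_shift k" \<mu> path_space f] assms
  by (simp add: measurable_mu measurable_int_shift int_shift_inv)

lemma integrable_int_shift:
  fixes f :: "_ \<Rightarrow> real"
  assumes "integrable \<mu> f"
  shows "integrable \<mu> (\<lambda>e. f (int_shift k e))"
  using integrable_distr[of "int_shift k" \<mu> path_space f] assms
  by (simp add: measurable_mu measurable_int_shift int_shift_inv)

text \<open>Integrating the functional equation kills p along the shift, because p and its translate have equal means.\<close>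

lemma subinvariant_AE_zero:
  fixes p :: "_ \<Rightarrow> real"
  assumes [measurable]: "p \<in> borel_measurable \<mu>" and p: "\<And>e. 0 \<le> p e" "\<And>e. p e \<le> 1"
    and eq: "\<And>e. p e = contr \<rho> (fst (e n)) * p (int_shift k e)"
  shows "AE e in \<mu>. p e = 0"
proof -
  have ip: "integrable \<mu> p"
    using p by (intro integrable_const_bound[where B=1]) auto
  note ip' = integrable_int_shift[OF ip, of k]
  have "AE e in \<mu>. p (int_shift k e) - p e = 0"
  proof (subst integral_nonneg_eq_0_iff_AE[symmetric])
    show "integrable \<mu> (\<lambda>e. p (int_shift k e) - p e)" using ip ip' by simp
    show "AE e in \<mu>. 0 \<le> p (int_shift k e) - p e"
    proof (intro AE_I2)
      fix e
      have "contr \<rho> (fst (e n)) * p (int_shift k e) \<le> 1 * p (int_shift k e)"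
        using contr_bounds[OF rho, of "fst (e n)"] p(1) by (intro mult_right_mono) auto
      then show "0 \<le> p (int_shift k e) - p e" using eq[of e] by simp
    qed
    show "(\<integral>e. p (int_shift k e) - p e \<partial>\<mu>) = 0"
      using ip ip' by (simp add: integral_int_shift)
  qed
  then show ?thesis
  proof (rule AE_mp, intro AE_I2 impI)
    fix e assume "p (int_shift k e) - p e = 0"
    then have "p e = contr \<rho> (fst (e n)) * p e" using eq[of e] by simp
    then show "p e = 0" using contr_bounds(2)[OF rho, of "fst (e n)"] by simp
  qed
qed

lemma gap_measurable [measurable]: "(\<lambda>e. gap \<rho> e m n) \<in> borel_measurable \<mu>"
  by (induction m arbitrary: n) simp_all

lemma iter_measurable [measurable]: "(\<lambda>e. iter \<rho> e X m n) \<in> borel_measurable \<mu>"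
  by (induction m arbitrary: n) simp_all

lemma Wlim_measurable [measurable]: "(\<lambda>e. Wlim \<rho> e n) \<in> borel_measurable \<mu>"
  unfolding Wlim_def by measurable

text \<open>The decreasing limit inherits the functional equation, to which
  \<open>subinvariant_AE_zero\<close> applies. The parameters n and k serve both directions of
  time.\<close>

lemma AE_limit_zero:
  fixes g :: "nat \<Rightarrow> _ \<Rightarrow> real"
  assumes [measurable]: "\<And>m. g m \<in> borel_measurable \<mu>" and g: "\<And>m e. 0 \<le> g m e" "\<And>m e. g m e \<le> 1"
    and eq: "\<And>m e. g (Suc m) e = contr \<rho> (fst (e n)) * g m (int_shift k e)"
    and dec: "\<And>e. decseq (\<lambda>m. g m e)"
  shows "AE e in \<mu>. (\<lambda>m. g m e) \<longlonglongrightarrow> 0"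
proof -
  define p where "p e = lim (\<lambda>m. g m e)" for e
  have conv: "(\<lambda>m. g m e) \<longlonglongrightarrow> p e" for e
    unfolding p_def using decseq_convergent[OF dec, of 0 e] g by (metis limI)
  have "AE e in \<mu>. p e = 0"
  proof (rule subinvariant_AE_zero)
    show "p \<in> borel_measurable \<mu>" unfolding p_def by measurable
    show "0 \<le> p e" for e using conv by (rule LIMSEQ_le_const) (use g in auto)
    show "p e \<le> 1" for e using conv by (rule LIMSEQ_le_const2) (use g in auto)
    show "p e = contr \<rho> (fst (e n)) * p (int_shift k e)" for e
      using LIMSEQ_unique[OF LIMSEQ_Suc[OF conv[of e]]] tendsto_mult_left[OF conv[of "int_shift k e"], of "contr \<rho> (fst (e n))"]
      by (simp add: eq)
  qed
  then show ?thesis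
    by (rule AE_mp) (intro AE_I2 impI, use conv in metis)
qed

lemma gap_decseq: "decseq (\<lambda>m. gap \<rho> e m n)"
proof (rule decseq_SucI)
  fix m
  have "gap \<rho> e (m + 1) n = gap \<rho> e m n * gap \<rho> e 1 (n - int m)" by (rule gap_add)
  also have "\<dots> \<le> gap \<rho> e m n * 1"
    by (intro mult_left_mono gap_bounds rho)
  finally show "gap \<rho> e (Suc m) n \<le> gap \<rho> e m n" by simp
qed

lemma AE_gap_backward: "AE e in \<mu>. \<forall>n. (\<lambda>m. gap \<rho> e m n) \<longlonglongrightarrow> 0"
  unfolding AE_all_countable
proof
  fix n
  show "AE e in \<mu>. (\<lambda>m. gap \<rho> e m n) \<longlonglongrightarrow> 0"
  proof (rule AE_limit_zero)
    show "gap \<rho> e (Suc m) n = contr \<rho> (fst (e n)) * gap \<rho> (int_shift (- 1) e) m n" for e m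
      using gap_shift[of \<rho> e "- 1" m n] by (simp add: int_shift_def)
  qed (use gap_bounds rho gap_decseq in auto)
qed

text \<open>Product over the times 1, ..., m. The oldest factor is split off for the functional
  equation, the newest one for monotonicity.\<close>

lemma AE_gap_forward: "AE e in \<mu>. (\<lambda>m. gap \<rho> e m (int m)) \<longlonglongrightarrow> 0"
proof (rule AE_limit_zero)
  show "gap \<rho> e (Suc m) (int (Suc m)) = contr \<rho> (fst (e 1)) * gap \<rho> (int_shift 1 e) m (int m)" for e m
    using gap_shift[of \<rho> e 1 m "int m"] gap_add[of \<rho> e m 1 "int (Suc m)"]
    by (simp add: int_shift_def mult.commute add.commute)
  show "decseq (\<lambda>m. gap \<rho> e m (int m))" for e
  proof (rule decseq_SucI)
    fix m
    have "gap \<rho> e (Suc m) (int (Suc m)) = contr \<rho> (fst (e (1 + int m))) * gap \<rho> e m (int m)" by simp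
    also have "\<dots> \<le> 1 * gap \<rho> e m (int m)"
      using contr_bounds[OF rho, of "fst (e (1 + int m))"] by (intro mult_right_mono gap_bounds rho) auto
    finally show "gap \<rho> e (Suc m) (int (Suc m)) \<le> gap \<rho> e m (int m)" by simp
  qed
qed (use gap_bounds rho in auto)

end

section \<open>Means and time averages for ergodic channels\<close>

locale ergodic_channel = stationary_channel \<mu> \<rho>
  for \<mu> :: "(int \<Rightarrow> ('k::finite, 'n::finite) chan) measure" and \<rho> +
  assumes ergodic: "\<And>A. A \<in> sets path_space \<Longrightarrow> shift -` A \<inter> space path_space = A \<Longrightarrow> prob A = 0 \<or> prob A = 1"
    and second_moment: "integrable \<mu> (\<lambda>e. (norm (fst (e 0)))\<^sup>2)" "integrable \<mu> (\<lambda>e. (norm (snd (e 0)))\<^sup>2)"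
begin

sublocale ergodic_system \<mu> shift
proof
  show "shift \<in> \<mu> \<rightarrow>\<^sub>M \<mu>"
    using measurable_int_shift[of 1] by (simp add: shift_eq_int_shift measurable_mu measurable_cong_sets[OF refl sets_mu])
  show "distr \<mu> \<mu> shift = \<mu>"
    using shift_inv by (simp add: distr_cong[OF refl sets_mu])
  show "A \<in> sets \<mu> \<Longrightarrow> shift -` A \<inter> space \<mu> = A \<Longrightarrow> prob A = 0 \<or> prob A = 1" for A
    using ergodic[of A] by (simp add: sets_mu)
qed

definition cost_bound :: "(int \<Rightarrow> ('k, 'n) chan) \<Rightarrow> real" where
  "cost_bound e = CARD('n) * (\<rho> * (norm (fst (e 0)))\<^sup>2) + CARD('k) * (\<rho> * (norm (snd (e 0)))\<^sup>2)"

lemma integrable_cost_bound: "integrable \<mu> cost_bound"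
  unfolding cost_bound_def using second_moment by auto

lemma cost_le_bound: "W \<in> unit_interval \<Longrightarrow> norm (cost \<rho> (e 0) W) \<le> cost_bound e"
  using cost_bounds[OF rho, of W "e 0"] by (simp add: cost_bound_def)

text \<open>N times the mutual information, as the mean log determinants will show.\<close>

definition mean_cost :: real where
  "mean_cost = (\<integral>e. cost \<rho> (e 0) (Wlim \<rho> e (- 1)) \<partial>\<mu>)"

lemma AE_Wlim:
  "AE e in \<mu>. \<forall>n. Wlim \<rho> e n \<in> unit_interval \<and> hpd (Wlim \<rho> e n) \<and>
    Wlim \<rho> e n = Wmap \<rho> (fst (e n)) (snd (e n)) (Wlim \<rho> e (n - 1))"
  using AE_gap_backward by eventually_elim (use Wlim_unit_interval[OF rho] hpd_Wlim[OF rho] Wlim_rec[OF rho] in blast)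

lemma integrable_ldetF_Wlim: "integrable \<mu> (\<lambda>e. ldetF \<rho> (fst (e 0)) (Wlim \<rho> e (- 1)))"
proof (rule Bochner_Integration.integrable_bound[OF integrable_cost_bound])
  show "AE e in \<mu>. norm (ldetF \<rho> (fst (e 0)) (Wlim \<rho> e (- 1))) \<le> norm (cost_bound e)"
    using AE_Wlim
  proof eventually_elim
    case (elim e)
    then have "Wlim \<rho> e (- 1) \<in> unit_interval" by blast
    then have W: "hpsd (Wlim \<rho> e (- 1))" "Wlim \<rho> e (- 1) \<preceq> mat 1" by (auto simp: unit_interval_def)
    have "0 \<le> CARD('k) * (\<rho> * (norm (snd (e 0)))\<^sup>2)" using rho by simp
    then show ?case
      using ldetF_bounds[OF W rho, of "fst (e 0)"] unfolding cost_bound_def real_norm_def by linarith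
  qed
qed measurable

lemma integrable_ldet_Wlim: "integrable \<mu> (\<lambda>e. ldet (Wlim \<rho> e 0))"
proof (rule Bochner_Integration.integrable_bound[OF integrable_cost_bound])
  show "AE e in \<mu>. norm (ldet (Wlim \<rho> e 0)) \<le> norm (cost_bound e)"
    using AE_Wlim
  proof eventually_elim
    case (elim e)
    have eq: "Wlim \<rho> e 0 = Wmap \<rho> (fst (e 0)) (snd (e 0)) (Wlim \<rho> e (- 1))"
      using spec[OF elim, of 0] by simp
    have W: "hpsd (Wlim \<rho> e (- 1))" using elim hpd_imp_hpsd by blast
    have "0 \<le> CARD('n) * (\<rho> * (norm (fst (e 0)))\<^sup>2)" using rho by simp
    then show ?case
      using ldet_Wmap_bounds(1)[OF W rho, of "fst (e 0)" "snd (e 0)"]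
        ldet_Wmap_bounds(2)[OF W rho, of "snd (e 0)" "fst (e 0)"]
      unfolding cost_bound_def real_norm_def eq by linarith
  qed
qed measurable

lemma mean_cost_eq:
  "mean_cost = (\<integral>e. ldetF \<rho> (fst (e 0)) (Wlim \<rho> e (- 1)) \<partial>\<mu>) - (\<integral>e. ldet (Wlim \<rho> e 0) \<partial>\<mu>)"
proof -
  have "mean_cost = (\<integral>e. ldetF \<rho> (fst (e 0)) (Wlim \<rho> e (- 1)) - ldet (Wlim \<rho> e 0) \<partial>\<mu>)"
    unfolding mean_cost_def
  proof (rule integral_cong_AE)
    show "AE e in \<mu>. cost \<rho> (e 0) (Wlim \<rho> e (- 1)) = ldetF \<rho> (fst (e 0)) (Wlim \<rho> e (- 1)) - ldet (Wlim \<rho> e 0)"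
      using AE_Wlim
    proof eventually_elim
      case (elim e)
      show ?case using spec[OF elim, of 0] by (simp add: cost_def)
    qed
  qed measurable
  then show ?thesis
    by (simp add: Bochner_Integration.integral_diff[OF integrable_ldetF_Wlim integrable_ldet_Wlim])
qed

lemma integrable_cost_Wlim: "integrable \<mu> (\<lambda>e. cost \<rho> (e 0) (Wlim \<rho> e (- 1)))"
proof (rule Bochner_Integration.integrable_bound[OF integrable_cost_bound])
  show "AE e in \<mu>. norm (cost \<rho> (e 0) (Wlim \<rho> e (- 1))) \<le> norm (cost_bound e)"
    using AE_Wlim
  proof eventually_elim
    case (elim e)
    then have "Wlim \<rho> e (- 1) \<in> unit_interval" by blast
    from cost_le_bound[OF this, of e] show ?case by simp
  qed
qed measurable

lemma integrable_cost_iter: "integrable \<mu> (\<lambda>e. cost \<rho> (e a) (iter \<rho> e (mat 1) j (a - 1)))"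
proof -
  have "integrable \<mu> (\<lambda>e. cost \<rho> (e 0) (iter \<rho> e (mat 1) j (- 1)))"
  proof (rule Bochner_Integration.integrable_bound[OF integrable_cost_bound])
    show "AE e in \<mu>. norm (cost \<rho> (e 0) (iter \<rho> e (mat 1) j (- 1))) \<le> norm (cost_bound e)"
      by (intro AE_I2 order_trans[OF cost_le_bound[OF iter_unit_interval[OF rho]]]) auto
  qed measurable
  from integrable_int_shift[OF this, of a] show ?thesis
    by (simp add: int_shift_def iter_shift)
qed

lemma integral_cost_iter:
  "(\<integral>e. cost \<rho> (e a) (iter \<rho> e (mat 1) j (a - 1)) \<partial>\<mu>) = (\<integral>e. cost \<rho> (e 0) (iter \<rho> e (mat 1) j (- 1)) \<partial>\<mu>)"
  using integral_int_shift[of "\<lambda>e. cost \<rho> (e 0) (iter \<rho> e (mat 1) j (- 1))" a]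
  by (simp add: int_shift_def iter_shift)

lemma integral_cost_tendsto:
  "(\<lambda>j. \<integral>e. cost \<rho> (e 0) (iter \<rho> e (mat 1) j (- 1)) \<partial>\<mu>) \<longlonglongrightarrow> mean_cost"
  unfolding mean_cost_def
proof (rule integral_dominated_convergence[OF _ _ integrable_cost_bound])
  show "AE e in \<mu>. (\<lambda>j. cost \<rho> (e 0) (iter \<rho> e (mat 1) j (- 1))) \<longlonglongrightarrow> cost \<rho> (e 0) (Wlim \<rho> e (- 1))"
    using AE_gap_backward by eventually_elim (use cost_iter_tendsto[OF rho] in blast)
  show "AE e in \<mu>. norm (cost \<rho> (e 0) (iter \<rho> e (mat 1) j (- 1))) \<le> cost_bound e" for j
    by (intro AE_I2 cost_le_bound iter_unit_interval rho) simp
qed measurable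

text \<open>By stationarity the increment at time m + j, which sees j past steps, has the mean of
  the same quantity at time 0. Only n - m is left, and Cesaro means apply.\<close>

lemma mean_logdet_H:
  fixes m n :: int
  assumes "m \<le> n"
  shows "(\<lambda>e. logdet_H \<rho> (\<lambda>i. fst (e i)) (\<lambda>i. snd (e i)) m n) \<in> borel_measurable \<mu>"
    "(\<integral>e. logdet_H \<rho> (\<lambda>i. fst (e i)) (\<lambda>i. snd (e i)) m n \<partial>\<mu>)
    = (\<Sum>j<nat (n - m + 1). \<integral>e. cost \<rho> (e 0) (iter \<rho> e (mat 1) j (- 1)) \<partial>\<mu>)"
proof -
  have eq: "logdet_H \<rho> (\<lambda>i. fst (e i)) (\<lambda>i. snd (e i)) m n
    = (\<Sum>j<nat (n - m + 1). cost \<rho> (e (m + int j)) (iter \<rho> e (mat 1) j (m + int j - 1)))" for e :: "int \<Rightarrow> ('k, 'n) chan"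
    unfolding logdet_H_eq_sum[OF rho assms] Xseq_eq_iter by (simp add: cost_def)
  show "(\<lambda>e. logdet_H \<rho> (\<lambda>i. fst (e i)) (\<lambda>i. snd (e i)) m n) \<in> borel_measurable \<mu>"
    unfolding eq by measurable
  show "(\<integral>e. logdet_H \<rho> (\<lambda>i. fst (e i)) (\<lambda>i. snd (e i)) m n \<partial>\<mu>)
    = (\<Sum>j<nat (n - m + 1). \<integral>e. cost \<rho> (e 0) (iter \<rho> e (mat 1) j (- 1)) \<partial>\<mu>)"
    unfolding eq by (simp add: Bochner_Integration.integral_sum integrable_cost_iter integral_cost_iter)
qed

text \<open>The increments of the stationary solution are values of one function along the shift,
  which Birkhoff's theorem averages; those of the given orbit differ from them by a null
  sequence.\<close>

lemma AE_cost_average: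
  assumes X0: "hpsd X0"
  shows "AE e in \<mu>. (\<lambda>n. (\<Sum>l<n. ldetF \<rho> (fst (e (int l))) (Xseq \<rho> (\<lambda>i. fst (e i)) (\<lambda>i. snd (e i)) X0 l)
      - ldet (Xseq \<rho> (\<lambda>i. fst (e i)) (\<lambda>i. snd (e i)) X0 (Suc l))) / real n) \<longlonglongrightarrow> mean_cost"
  using birkhoff[OF integrable_cost_Wlim] AE_gap_forward AE_gap_backward
proof eventually_elim
  case (elim e)
  let ?W = "\<lambda>l. Wlim \<rho> e (int l - 1)" and ?X = "\<lambda>l. iter \<rho> e X0 l (int l - 1)"
  let ?d = "\<lambda>l. cost \<rho> (e (int l)) (?X l) - cost \<rho> (e (int l)) (?W l)"
  have Xs: "Xseq \<rho> (\<lambda>i. fst (e i)) (\<lambda>i. snd (e i)) X0 l = ?X l" for l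
    using Xseq_eq_iter[of \<rho> e 0 X0 l] by simp
  have g: "\<And>n. (\<lambda>m. gap \<rho> e m n) \<longlonglongrightarrow> 0" using elim(3) by blast
  \<comment> \<open>\<open>X0\<close> need not lie below the identity, so the comparison starts
    after one step of the recursion, when both orbits are in the order interval.\<close>
  have "(\<lambda>l. ?d (Suc l)) \<longlonglongrightarrow> 0"
  proof (rule Lim_null_comparison)
    have "\<forall>\<^sub>F l in sequentially. gap \<rho> e l (int l) < 1"
      using elim(2) by (rule order_tendstoD) simp
    then show "\<forall>\<^sub>F l in sequentially. norm (?d (Suc l)) \<le> (CARD('n) + CARD('k)) * (- ln (1 - gap \<rho> e l (int l)))"
    proof eventually_elim
      case (elim l)
      have "?X (Suc l) = iter \<rho> e (Wmap \<rho> (fst (e 0)) (snd (e 0)) X0) l (int l)"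
        using iter_add[of \<rho> e X0 l 1 "int l"] by simp
      moreover have "?W (Suc l) = iter \<rho> e (Wlim \<rho> e 0) l (int l)"
        using Wlim_eq_iter[OF rho g, of "int l" l] by simp
      ultimately show ?case
        using cost_iter_diff[OF rho Wmap_unit_interval[OF rho X0, of "fst (e 0)" "snd (e 0)"]
            Wlim_unit_interval[OF rho g, of 0] elim, of "e (int (Suc l))"] by simp
    qed
    have "(\<lambda>l. (CARD('n) + CARD('k)) * (- ln (1 - gap \<rho> e l (int l)))) \<longlonglongrightarrow> (CARD('n) + CARD('k)) * (- ln (1 - 0))"
      by (intro tendsto_intros elim) auto
    then show "(\<lambda>l. (CARD('n) + CARD('k)) * (- ln (1 - gap \<rho> e l (int l)))) \<longlonglongrightarrow> 0" by simp
  qed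
  then have "?d \<longlonglongrightarrow> 0" by (rule LIMSEQ_imp_Suc)
  from cesaro_mean_LIMSEQ[OF this]
  have "(\<lambda>n. (\<Sum>l<n. ?d l) / real n) \<longlonglongrightarrow> 0" .
  \<comment> \<open>Equivariance rewrites the time average as a Birkhoff average of the function
    whose mean is \<open>mean_cost\<close>.\<close>
  moreover have "(\<lambda>n. (\<Sum>l<n. cost \<rho> (e (int l)) (?W l)) / real n) \<longlonglongrightarrow> mean_cost"
    using elim(1) Wlim_shift[of \<rho> e _ "- 1"] by (simp add: funpow_shift mean_cost_def)
  ultimately have "(\<lambda>n. (\<Sum>l<n. ?d l) / real n + (\<Sum>l<n. cost \<rho> (e (int l)) (?W l)) / real n) \<longlonglongrightarrow> 0 + mean_cost"
    by (rule tendsto_add)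
  then have "(\<lambda>n. (\<Sum>l<n. cost \<rho> (e (int l)) (?X l)) / real n) \<longlonglongrightarrow> mean_cost"
    by (simp add: sum_subtractf diff_divide_distrib)
  then show ?case by (simp only: Xs) (simp add: cost_def)
qed

end

section \<open>Transfer to the given probability space\<close>

lemma norm_le_specnorm: "norm (A :: complex^'b^'a) \<le> CARD('a) * (CARD('b) * specnorm A)"
proof (rule norm_mat_le)
  fix i j
  have "A $ i $ j = (A *v axis j 1) $ i"
    by (simp add: axis_def matrix_vector_mult_def if_distrib cong: if_cong)
  also have "norm \<dots> \<le> norm (A *v axis j 1)" by (rule Finite_Cartesian_Product.norm_nth_le)
  also have "\<dots> \<le> onorm ((*v) A) * norm (axis j 1 :: complex^'b)"
    by (rule onorm) simp
  finally show "norm (A $ i $ j) \<le> specnorm A" by (simp add: specnorm_def norm_axis_1)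
qed

text \<open>The Frobenius norm is at most a constant times the spectral norm, so the moment
  hypotheses reach the norm in which the estimates are stated.\<close>

lemma integrable_norm_sq:
  assumes [measurable]: "f \<in> borel_measurable M" and "integrable M (\<lambda>\<omega>. (specnorm (f \<omega>))\<^sup>2)"
  shows "integrable M (\<lambda>\<omega>. (norm (f \<omega> :: complex^'b^'a))\<^sup>2)"
proof (rule Bochner_Integration.integrable_bound)
  let ?c = "real CARD('a) * real CARD('b)"
  show "integrable M (\<lambda>\<omega>. ?c\<^sup>2 * (specnorm (f \<omega>))\<^sup>2)" using assms by simp
  show "AE \<omega> in M. norm ((norm (f \<omega>))\<^sup>2) \<le> norm (?c\<^sup>2 * (specnorm (f \<omega>))\<^sup>2)"
  proof (intro AE_I2)
    fix \<omega>
    have "(norm (f \<omega>))\<^sup>2 \<le> (?c * specnorm (f \<omega>))\<^sup>2"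
      using norm_le_specnorm[of "f \<omega>"] by (intro power_mono) (auto simp: mult.assoc)
    then show "norm ((norm (f \<omega>))\<^sup>2) \<le> norm (?c\<^sup>2 * (specnorm (f \<omega>))\<^sup>2)"
      by (simp add: power_mult_distrib)
  qed
qed measurable

lemma Wlim_comp_shift: "Wlim \<rho> (shift e) = shift (Wlim \<rho> e)"
  using Wlim_shift[of \<rho> e 1] by (simp add: fun_eq_iff shift_def)

lemma filterlim_gap: "filterlim (\<lambda>mn. nat (snd mn - fst mn + 1)) sequentially gap_filter"
proof -
  have "filterlim (\<lambda>d::int. nat (d + 1)) sequentially at_top"
    unfolding filterlim_at_top
  proof
    fix Z
    show "\<forall>\<^sub>F d in at_top. Z \<le> nat (d + 1)"
      using eventually_ge_at_top[of "int Z"] by eventually_elim auto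
  qed
  from filterlim_compose[OF this filterlim_filtercomap, of "\<lambda>(m, n). n - m"] show ?thesis
    by (simp add: case_prod_unfold)
qed

lemma eventually_gap_ge: "\<forall>\<^sub>F mn in gap_filter. fst mn \<le> snd mn"
  using eventually_filtercomapI[OF eventually_ge_at_top[of "0::int"], of "\<lambda>(m, n). n - m"]
  by (simp add: case_prod_unfold)

text \<open>\<open>mutual_info\<close> is a \<open>Lim\<close>, whose value a convergence statement
  determines only along a nontrivial filter.\<close>

lemma gap_filter_neq_bot: "gap_filter \<noteq> bot"
proof (rule filtercomap_neq_bot_surj)
  show "surj (\<lambda>(m, n). n - m :: int)"
    by (rule surjI[of _ "\<lambda>d. (0, d)"]) simp
qed simp

theorem theorem1:
  fixes M :: "'w measure"
    and FG :: "'w \<Rightarrow> int \<Rightarrow> (complex^'k^'n) \<times> (complex^'k^'n)"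
    and \<rho> :: real
  assumes M: "prob_space M"
    and stat: "stationary_proc M FG"
    and erg: "ergodic_proc M FG"
    and momF: "integrable M (\<lambda>\<omega>. (specnorm (fst (FG \<omega> 0)))\<^sup>2)"
    and momG: "integrable M (\<lambda>\<omega>. (specnorm (snd (FG \<omega> 0)))\<^sup>2)"
    and rho: "\<rho> > 0"
  shows
    "(\<exists>W :: 'w \<Rightarrow> int \<Rightarrow> complex^'k^'k.
        \<comment> \<open>(a) existence\<close>
        stationary_proc M W \<and>
        (\<forall>n. AE \<omega> in M. hpd (W \<omega> n)) \<and>
        (\<forall>n. AE \<omega> in M. W \<omega> n = Wmap \<rho> (fst (FG \<omega> n)) (snd (FG \<omega> n)) (W \<omega> (n - 1))) \<and>
        \<comment> \<open>(a) uniqueness\<close>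
        (\<forall>W' :: 'w \<Rightarrow> int \<Rightarrow> complex^'k^'k.
           stationary_proc M W' \<and>
           (\<forall>n. AE \<omega> in M. hpd (W' \<omega> n)) \<and>
           (\<forall>n. AE \<omega> in M. W' \<omega> n = Wmap \<rho> (fst (FG \<omega> n)) (snd (FG \<omega> n)) (W' \<omega> (n - 1)))
           \<longrightarrow> (\<forall>n. AE \<omega> in M. W' \<omega> n = W \<omega> n)) \<and>
        \<comment> \<open>(a) ergodicity\<close>
        ergodic_proc M W \<and>
        \<comment> \<open>(b)\<close>
        integrable M (\<lambda>\<omega>. ldetF \<rho> (fst (FG \<omega> 0)) (W \<omega> (-1))) \<and>
        integrable M (\<lambda>\<omega>. ldet (W \<omega> 0)) \<and>
        (MI_approx M \<rho> FG \<longlongrightarrow>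
           ((\<integral>\<omega>. ldetF \<rho> (fst (FG \<omega> 0)) (W \<omega> (-1)) \<partial>M) - (\<integral>\<omega>. ldet (W \<omega> 0) \<partial>M)) / real CARD('n))
          gap_filter \<and>
        mutual_info M \<rho> FG =
          ((\<integral>\<omega>. ldetF \<rho> (fst (FG \<omega> 0)) (W \<omega> (-1)) \<partial>M) - (\<integral>\<omega>. ldet (W \<omega> 0) \<partial>M)) / real CARD('n))
     \<and>
     \<comment> \<open>(c)\<close>
     (\<forall>X0 :: complex^'k^'k. hpsd X0 \<longrightarrow>
        (AE \<omega> in M.
           (\<lambda>n. (\<Sum>l<n. ldetF \<rho> (fst (FG \<omega> (int l))) (Xseq \<rho> (\<lambda>i. fst (FG \<omega> i)) (\<lambda>i. snd (FG \<omega> i)) X0 l)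
                        - ldet (Xseq \<rho> (\<lambda>i. fst (FG \<omega> i)) (\<lambda>i. snd (FG \<omega> i)) X0 (Suc l)))
                 / (real n * real CARD('n)))
           \<longlonglongrightarrow> mutual_info M \<rho> FG))"
proof -
  interpret M: prob_space M by (rule M)
  let ?P = "path_space :: (int \<Rightarrow> ('k, 'n) chan) measure"
  let ?Q = "path_space :: (int \<Rightarrow> complex^'k^'k) measure"
  let ?\<mu> = "distr M ?P FG"
  have FG[measurable]: "FG \<in> M \<rightarrow>\<^sub>M ?P" and FG_shift: "distr M ?P (\<lambda>\<omega>. shift (FG \<omega>)) = ?\<mu>"
    using stat by (auto simp: stationary_proc_def)
  have shift_meas: "shift \<in> ?P \<rightarrow>\<^sub>M ?P"
    unfolding shift_eq_int_shift by (rule measurable_int_shift)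
  have comp: "(\<lambda>\<omega>. FG \<omega> 0) \<in> borel_measurable M"
    by (rule measurable_compose[OF FG path_component_measurable])
  have comp0: "(\<lambda>e. e 0) \<in> borel_measurable ?P" by (rule path_component_measurable)
  have P: "prob_space ?\<mu>" by (rule M.prob_space_distr[OF FG])
  \<comment> \<open>The law of the channel is the ergodic system; what holds almost everywhere for
    it pulls back to \<open>M\<close> along \<open>FG\<close>.\<close>
  interpret ch: ergodic_channel ?\<mu> \<rho>
  proof (intro ergodic_channel.intro stationary_channel.intro P stationary_channel_axioms.intro ergodic_channel_axioms.intro)
    show "distr ?\<mu> ?P shift = ?\<mu>"
      using FG_shift by (subst distr_distr) (auto simp: shift_meas comp_def)
    show "measure ?\<mu> A = 0 \<or> measure ?\<mu> A = 1" if "A \<in> sets ?P" "shift -` A \<inter> space ?P = A" for A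
      using erg that unfolding ergodic_proc_def by blast
    show "integrable ?\<mu> (\<lambda>e. (norm (fst (e 0)))\<^sup>2)"
      using integrable_norm_sq[OF borel_measurable_fst[OF comp] momF]
      by (subst integrable_distr_eq) (auto intro!: borel_measurable_power borel_measurable_norm borel_measurable_fst comp0)
    show "integrable ?\<mu> (\<lambda>e. (norm (snd (e 0)))\<^sup>2)"
      using integrable_norm_sq[OF borel_measurable_snd[OF comp] momG]
      by (subst integrable_distr_eq) (auto intro!: borel_measurable_power borel_measurable_norm borel_measurable_snd comp0)
  qed (use rho in auto)
  let ?N = "real CARD('n)"
  let ?W = "\<lambda>\<omega>. Wlim \<rho> (FG \<omega>)"
  have Wlim_meas: "Wlim \<rho> \<in> ?P \<rightarrow>\<^sub>M ?Q"
    using ch.Wlim_measurable by (intro measurable_path) simp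
  have W_meas: "?W \<in> M \<rightarrow>\<^sub>M ?Q" by (rule measurable_compose[OF FG Wlim_meas])
  have AE_M: "AE \<omega> in M. R (FG \<omega>)" if "AE e in ?\<mu>. R e" for R
    using AE_distrD[OF FG that] .
  have W_AE: "AE \<omega> in M. \<forall>n. ?W \<omega> n \<in> unit_interval \<and> hpd (?W \<omega> n) \<and>
    ?W \<omega> n = Wmap \<rho> (fst (FG \<omega> n)) (snd (FG \<omega> n)) (?W \<omega> (n - 1))"
    by (rule AE_M[OF ch.AE_Wlim])
  have stationary: "stationary_proc M ?W"
    unfolding stationary_proc_def
  proof (intro conjI W_meas)
    \<comment> \<open>Equivariance moves the shift from the solution to the channel, whose law
      absorbs it.\<close>
    have "distr M ?Q (\<lambda>\<omega>. shift (?W \<omega>)) = distr (distr M ?P (\<lambda>\<omega>. shift (FG \<omega>))) ?Q (Wlim \<rho>)"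
      using measurable_compose[OF FG shift_meas]
      by (subst distr_distr[OF Wlim_meas]) (auto simp: comp_def Wlim_comp_shift)
    also have "\<dots> = distr M ?Q ?W"
      unfolding FG_shift by (subst distr_distr[OF Wlim_meas FG]) (simp add: comp_def)
    finally show "distr M ?Q (\<lambda>\<omega>. shift (?W \<omega>)) = distr M ?Q ?W" .
  qed
  have ergodic: "ergodic_proc M ?W"
    unfolding ergodic_proc_def
  proof (intro ballI impI)
    fix A assume A: "A \<in> sets ?Q" and inv: "shift -` A \<inter> space ?Q = A"
    \<comment> \<open>The preimage of an invariant set under an equivariant map is invariant, so
      ergodicity passes from the channel to the solution.\<close>
    let ?B = "Wlim \<rho> -` A \<inter> space ?P"
    have B: "?B \<in> sets ?P" using measurable_sets[OF Wlim_meas A] .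
    have "shift e \<in> ?B \<longleftrightarrow> e \<in> ?B" for e
      using inv by (auto simp: Wlim_comp_shift)
    then have "shift -` ?B \<inter> space ?P = ?B" by auto
    moreover have "measure (distr M ?Q ?W) A = measure ?\<mu> ?B"
      using A B FG W_meas by (subst (1 2) measure_distr) (auto simp: vimage_def)
    ultimately show "measure (distr M ?Q ?W) A = 0 \<or> measure (distr M ?Q ?W) A = 1"
      using erg B unfolding ergodic_proc_def by simp
  qed
  have unique: "AE \<omega> in M. W' \<omega> n = ?W \<omega> n"
    if "\<forall>n. AE \<omega> in M. hpd (W' \<omega> n)"
      "\<forall>n. AE \<omega> in M. W' \<omega> n = Wmap \<rho> (fst (FG \<omega> n)) (snd (FG \<omega> n)) (W' \<omega> (n - 1))" for W' n
    \<comment> \<open>The null sets for the countably many n are merged, so that the whole two-sided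
      solution is available on one path.\<close>
    using that[folded AE_all_countable] AE_M[OF ch.AE_gap_backward]
  proof eventually_elim
    case (elim \<omega>)
    show ?case
    proof (rule Wlim_unique[where W = "W' \<omega>"])
      show "0 \<le> \<rho>" using rho by simp
      show "(\<lambda>m. gap \<rho> (FG \<omega>) m n) \<longlonglongrightarrow> 0" for n using elim(3) by blast
      show "hpsd (W' \<omega> n)" for n using elim(1) hpd_imp_hpsd by blast
      show "W' \<omega> n = Wmap \<rho> (fst (FG \<omega> n)) (snd (FG \<omega> n)) (W' \<omega> (n - 1))" for n
        using elim(2) by blast
    qed
  qed
  have int1: "(\<integral>e. ldetF \<rho> (fst (e 0)) (Wlim \<rho> e (- 1)) \<partial>?\<mu>) = (\<integral>\<omega>. ldetF \<rho> (fst (FG \<omega> 0)) (?W \<omega> (- 1)) \<partial>M)"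
    using ch.integrable_ldetF_Wlim by (subst integral_distr[OF FG]) auto
  have int2: "(\<integral>e. ldet (Wlim \<rho> e 0) \<partial>?\<mu>) = (\<integral>\<omega>. ldet (?W \<omega> 0) \<partial>M)"
    using ch.integrable_ldet_Wlim by (subst integral_distr[OF FG]) auto
  have I: "ch.mean_cost = (\<integral>\<omega>. ldetF \<rho> (fst (FG \<omega> 0)) (?W \<omega> (- 1)) \<partial>M) - (\<integral>\<omega>. ldet (?W \<omega> 0) \<partial>M)"
    unfolding ch.mean_cost_eq int1 int2 ..
  have MI: "(MI_approx M \<rho> FG \<longlongrightarrow> ch.mean_cost / ?N) gap_filter"
  proof (rule Lim_transform_eventually)
    let ?a = "\<lambda>j. \<integral>e. cost \<rho> (e 0) (iter \<rho> e (mat 1) j (- 1)) \<partial>?\<mu>"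
    \<comment> \<open>With the number of block rows in place of L this Cesaro mean is
      \<open>MI_approx\<close>.\<close>
    let ?h = "\<lambda>L. (\<Sum>j<L. ?a j) / real L / ?N"
    have "?h \<longlonglongrightarrow> ch.mean_cost / ?N"
      by (intro tendsto_divide tendsto_const cesaro_mean_LIMSEQ ch.integral_cost_tendsto) simp
    then show "((\<lambda>mn. ?h (nat (snd mn - fst mn + 1))) \<longlongrightarrow> ch.mean_cost / ?N) gap_filter"
      by (rule filterlim_compose[OF _ filterlim_gap])
    show "\<forall>\<^sub>F mn in gap_filter. ?h (nat (snd mn - fst mn + 1)) = MI_approx M \<rho> FG mn"
      using eventually_gap_ge
    proof eventually_elim
      case (elim mn)
      obtain m n where mn: "mn = (m, n)" by (cases mn)
      then have le: "m \<le> n" using elim by simp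
      have "(\<integral>\<omega>. logdet_H \<rho> (\<lambda>i. fst (FG \<omega> i)) (\<lambda>i. snd (FG \<omega> i)) m n \<partial>M) = (\<Sum>j<nat (n - m + 1). ?a j)"
        unfolding ch.mean_logdet_H(2)[OF le, symmetric]
        using ch.mean_logdet_H(1)[OF le] by (subst integral_distr[OF FG]) auto
      then show ?case using le by (simp add: MI_approx_def mn)
    qed
  qed
  have mutual: "mutual_info M \<rho> FG = ch.mean_cost / ?N"
    unfolding mutual_info_def by (rule tendsto_Lim[OF gap_filter_neq_bot MI])
  have average: "AE \<omega> in M.
           (\<lambda>n. (\<Sum>l<n. ldetF \<rho> (fst (FG \<omega> (int l))) (Xseq \<rho> (\<lambda>i. fst (FG \<omega> i)) (\<lambda>i. snd (FG \<omega> i)) X0 l)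
                        - ldet (Xseq \<rho> (\<lambda>i. fst (FG \<omega> i)) (\<lambda>i. snd (FG \<omega> i)) X0 (Suc l)))
                 / (real n * ?N)) \<longlonglongrightarrow> mutual_info M \<rho> FG" if "hpsd X0" for X0
    using AE_M[OF ch.AE_cost_average[OF that]]
  proof eventually_elim
    case (elim \<omega>)
    from tendsto_divide[OF elim tendsto_const[of ?N]] show ?case
      unfolding mutual by (simp add: field_simps)
  qed
  show ?thesis
  proof (intro conjI exI[of _ ?W] allI impI)
    show "AE \<omega> in M. hpd (?W \<omega> n)" for n using W_AE by eventually_elim blast
    show "AE \<omega> in M. ?W \<omega> n = Wmap \<rho> (fst (FG \<omega> n)) (snd (FG \<omega> n)) (?W \<omega> (n - 1))" for n
      using W_AE by eventually_elim blast
    show "integrable M (\<lambda>\<omega>. ldetF \<rho> (fst (FG \<omega> 0)) (?W \<omega> (- 1)))"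
      using ch.integrable_ldetF_Wlim by (subst (asm) integrable_distr_eq[OF FG]) auto
    show "integrable M (\<lambda>\<omega>. ldet (?W \<omega> 0))"
      using ch.integrable_ldet_Wlim by (subst (asm) integrable_distr_eq[OF FG]) auto
    show "(MI_approx M \<rho> FG \<longlongrightarrow>
       ((\<integral>\<omega>. ldetF \<rho> (fst (FG \<omega> 0)) (?W \<omega> (- 1)) \<partial>M) - (\<integral>\<omega>. ldet (?W \<omega> 0) \<partial>M)) / ?N) gap_filter"
      using MI unfolding I .
    show "mutual_info M \<rho> FG =
       ((\<integral>\<omega>. ldetF \<rho> (fst (FG \<omega> 0)) (?W \<omega> (- 1)) \<partial>M) - (\<integral>\<omega>. ldet (?W \<omega> 0) \<partial>M)) / ?N"
      using mutual unfolding I .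
  qed (use stationary ergodic unique average in blast)+
qed

end
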